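(* Let $1\le n<N$. For every pair $(A,B)\in\mathbf{H}_N\times\mathbf{H}_N$ with $B\prec 0$ (and with $\lambda_g:=\lambda_{n+1}-\lambda_n>0$, where $\lambda_1\le\cdots\le\lambda_N$ are the eigenvalues of $A+B$), the fixed point iteration $$(A+\underline{B}[V^{(k)}])\,v_i^{(k+1)}=\lambda_i^{(k+1)}v_i^{(k+1)},\qquad i=1,\dots,n,$$ viewed as a map $P^{(k)}\mapsto P^{(k+1)}$ with $P^{(k)}=V^{(k)}(V^{(k)})^*$, converges locally to $P=VV^*$. The number of matrix-vector multiplications $Bv$ needed for $k$ steps of the fixed point iteration is $nk$. Starting from $P^{(0)}\in\mathcal{D}$, the asymptotic convergence rate is $$\|P-P^{(k)}\|_2\lesssim\gamma^k\,\|P-P^{(0)}\|_2,\qquad\text{where}\quad \gamma\le\frac{\|B\|_2}{\|B\|_2+\lambda_g}.$$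
   Context: $\mathbf{H}_N$ is the set of Hermitian $N\times N$ matrices, $\mathcal{D}\subset\mathbb{C}^{N\times N}$ is the set of rank-$n$ orthogonal projectors on $\mathbb{C}^N$, and $\|\cdot\|_2$ is the spectral norm. $V=[v_1,\dots,v_n]$ has as columns orthonormal eigenvectors of $A+B$ for its $n$ lowest eigenvalues $\lambda_1\le\cdots\le\lambda_n$, so $P=VV^*$ is the orthogonal projector onto the span of these eigenvectors. For an $N\times n$ matrix $V'$ with linearly independent columns, the adaptive compression of $B\prec0$ is $\underline{B}[V']=BV'\,(V'^*BV')^{-1}\,V'^*B$; it depends only on the column span of $V'$. In the iteration, $V^{(k)}=[v_1^{(k)},\dots,v_n^{(k)}]$ has orthonormal columns, and $\lambda_1^{(k+1)}\le\cdots\le\lambda_n^{(k+1)}$ are the $n$ lowest eigenvalues (with multiplicity) of $A+\underline{B}[V^{(k)}]$, with orthonormal eigenvectors $v_1^{(k+1)},\dots,v_n^{(k+1)}$ (if the $n$-th and $(n+1)$-th eigenvalues of $A+\underline{B}[V^{(k)}]$ coincide, an arbitrary choice is made in the eigenspace of the $n$-th eigenvalue). The matrix $B$ is applied to vectors only in forming $BV^{(k)}$, once per step. "Converges locally to $P$" means that $P^{(k)}\to P$ whenever $P^{(0)}\in\mathcal{D}$ is sufficiently close to $P$. The symbol $\lesssim$ denotes inequality up to a multiplicative constant independent of $k$. *)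

theory Defs
  imports "HOL-Analysis.Analysis" "HOL-Library.Multiset"
begin

definition adj :: "complex^'n^'m \<Rightarrow> complex^'m^'n" where
  "adj M = (\<chi> i j. cnj (M $ j $ i))"

definition hermitian :: "complex^'n^'n \<Rightarrow> bool" where
  "hermitian M \<longleftrightarrow> adj M = M"

text \<open>The inner product of the library on \<^typ>\<open>complex^'n\<close> is the real one, that is, the real
  part of the complex sesquilinear product.  For Hermitian \<open>M\<close> the number \<open>x\<^sup>* M x\<close> is real, so
  \<^term>\<open>x \<bullet> (M *v x)\<close> is exactly \<open>x\<^sup>* M x\<close>.\<close>

definition neg_definite :: "complex^'n^'n \<Rightarrow> bool" where
  "neg_definite M \<longleftrightarrow> hermitian M \<and> (\<forall>x. x \<noteq> 0 \<longrightarrow> x \<bullet> (M *v x) < 0)"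

definition spectral_norm :: "complex^'n^'m \<Rightarrow> real" where
  "spectral_norm M = onorm (\<lambda>x. M *v x)"

definition eigenspace :: "complex^'n^'n \<Rightarrow> real \<Rightarrow> (complex^'n) set" where
  "eigenspace M x = {v. M *v v = complex_of_real x *s v}"

text \<open>The real eigenvalues in ascending order, each repeated according to its complex geometric
  multiplicity (\<^const>\<open>vec.dim\<close> is the dimension over the ground field \<open>\<complex>\<close>, unlike \<^const>\<open>dim\<close>).
  For a Hermitian matrix the list therefore has length \<open>CARD('n)\<close>.  Lists are indexed from \<open>0\<close>:
  \<open>\<lambda>\<^sub>j\<close> is \<open>eigenvalues M ! (j - 1)\<close>.\<close>

definition eigenvalues :: "complex^'n^'n \<Rightarrow> real list" where
  "eigenvalues M = sorted_list_of_multiset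
     (\<Sum>x \<in> {x. eigenspace M x \<noteq> {0}}. replicate_mset (vec.dim (eigenspace M x)) x)"

definition eigengap :: "nat \<Rightarrow> complex^'n^'n \<Rightarrow> real" where
  "eigengap n M = eigenvalues M ! n - eigenvalues M ! (n - 1)"

definition rank_projectors :: "nat \<Rightarrow> (complex^'n^'n) set" where
  "rank_projectors n = {P. hermitian P \<and> P ** P = P \<and> rank P = n}"

text \<open>An \<open>N \<times> n\<close> matrix has type \<^typ>\<open>complex^'n^'N\<close>; its columns are indexed by a finite linearly
  ordered type \<open>'n\<close>, and the index \<open>i\<close> stands for the number \<open>col_index i + 1\<close> in \<open>{1..n}\<close>.\<close>

definition col_index :: "'n::{finite,linorder} \<Rightarrow> nat" where
  "col_index i = card {j. j < i}"

definition orthonormal_columns :: "complex^'n^'m \<Rightarrow> bool" where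
  "orthonormal_columns V \<longleftrightarrow> adj V ** V = mat 1"

definition col_projector :: "complex^'n^'m \<Rightarrow> complex^'m^'m" where
  "col_projector V = V ** adj V"

definition lowest_eigenvectors ::
    "complex^'m^'m \<Rightarrow> complex^('n::{finite,linorder})^'m \<Rightarrow> bool" where
  "lowest_eigenvectors M V \<longleftrightarrow> orthonormal_columns V \<and>
     (\<forall>i. M *v column i V = complex_of_real (eigenvalues M ! col_index i) *s column i V)"

definition compression :: "complex^'m^'m \<Rightarrow> complex^'n^'m \<Rightarrow> complex^'m^'m" where
  "compression B V = B ** V ** matrix_inv (adj V ** B ** V) ** adj V ** B"

text \<open>The iteration is a relation, because the eigenvectors (and, if the \<open>n\<close>-th eigenvalue is
  degenerate, their span) are not determined by the matrix; every choice is allowed in every step.\<close>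

definition aci_iteration ::
    "complex^'m^'m \<Rightarrow> complex^'m^'m \<Rightarrow> (nat \<Rightarrow> complex^('n::{finite,linorder})^'m) \<Rightarrow> bool" where
  "aci_iteration A B W \<longleftrightarrow> orthonormal_columns (W 0) \<and>
     (\<forall>k. lowest_eigenvectors (A + compression B (W k)) (W (Suc k)))"

text \<open>To count products \<open>Bv\<close>, the iteration is written as a program whose only access to \<open>B\<close> is by
  queries: a query \<open>q\<close> is answered by \<open>f q\<close>, where \<open>f\<close> will be \<open>v \<mapsto> Bv\<close>.\<close>

datatype ('q, 'a, 'r) query_program =
    Return 'r
  | Query 'q "'a \<Rightarrow> ('q, 'a, 'r) query_program"

primrec program_result :: "('q \<Rightarrow> 'a) \<Rightarrow> ('q, 'a, 'r) query_program \<Rightarrow> 'r" where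
  "program_result f (Return r) = r"
| "program_result f (Query q c) = program_result f (c (f q))"

primrec query_count :: "('q \<Rightarrow> 'a) \<Rightarrow> ('q, 'a, 'r) query_program \<Rightarrow> nat" where
  "query_count f (Return r) = 0"
| "query_count f (Query q c) = Suc (query_count f (c (f q)))"

primrec query_list ::
    "'q list \<Rightarrow> ('a list \<Rightarrow> ('q, 'a, 'r) query_program) \<Rightarrow> ('q, 'a, 'r) query_program" where
  "query_list [] c = c []"
| "query_list (q # qs) c = Query q (\<lambda>a. query_list qs (\<lambda>as. c (a # as)))"

definition column_list :: "complex^('n::{finite,linorder})^'m \<Rightarrow> (complex^'m) list" where
  "column_list V = map (\<lambda>i. column i V) (sorted_list_of_set UNIV)"

definition matrix_of_column_list ::
    "(complex^'m) list \<Rightarrow> complex^('n::{finite,linorder})^'m" where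
  "matrix_of_column_list ws = (\<chi> r i. (ws ! col_index i) $ r)"

text \<open>\<open>k\<close> steps from \<open>V\<close>: with \<open>Y = BV\<close> obtained from the queries, the compression is
  \<open>Y (V\<^sup>* Y)\<^sup>-\<^sup>1 Y\<^sup>*\<close>.  The eigensolver of step \<open>j\<close> is \<open>solve j\<close>; it receives the compressed matrix only.\<close>

primrec aci_program ::
    "complex^'m^'m \<Rightarrow> nat \<Rightarrow> (nat \<Rightarrow> complex^'m^'m \<Rightarrow> complex^('n::{finite,linorder})^'m) \<Rightarrow>
     complex^('n::{finite,linorder})^'m \<Rightarrow>
     (complex^'m, complex^'m, complex^('n::{finite,linorder})^'m) query_program" where
  "aci_program A 0 solve V = Return V"
| "aci_program A (Suc k) solve V =
     query_list (column_list V) (\<lambda>ws.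
       let Y = matrix_of_column_list ws
       in aci_program A k (\<lambda>j. solve (Suc j))
            (solve 0 (A + Y ** matrix_inv (adj V ** Y) ** adj Y)))"

end

theory Submission
  imports Defs
begin

text \<open>
  Let \<open>H = A + B\<close> with spectral projector \<open>P\<close>, let \<open>D(W) = compression B W - B\<close>, and write
  \<open>|y|\<^sub>D\<close> for the seminorm \<open>(y\<^sup>* D y)\<^sup>1\<^sup>/\<^sup>2\<close>.  A step of the iteration takes the lowest eigenvectors
  of \<open>H + D(W)\<close>.

  The form \<open>y\<^sup>* D(W) y\<close> is the squared distance of \<open>y\<close> from the range of \<open>W\<close> in the inner product of
  \<open>- B\<close> (\<open>defect_form_attained\<close>).  Hence \<open>0 \<le> D(W) \<le> - B\<close>, the matrix \<open>D(W)\<close> vanishes on the range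
  of \<open>W\<close>, and it is Lipschitz in that range (\<open>energy_defect_compare\<close>).

  Let \<open>v\<close> be an eigenvector of \<open>H + D(W)\<close> for \<open>r\<close>, let \<open>w\<close> be the vector in the range of \<open>W\<close> with
  \<open>P w = P v\<close>, and let \<open>y = (1 - P) v\<close> and \<open>x = (1 - P) w\<close>.  Since \<open>D w = 0\<close> and \<open>v - w = y - x\<close>,
  the component of the eigenvalue equation outside of the range of \<open>P\<close> is exactly
  \<open>(H - r) y + (1 - P) D (y - x) = 0\<close>.  Pairing with \<open>y\<close>, and using \<open>H \<ge> \<lambda>\<^sub>n\<^sub>+\<^sub>1\<close> on the complement,
  \<open>D \<le> \<parallel>B\<parallel>\<close> and the Cauchy--Schwarz inequality, one gets
  \<open>(1 + (\<lambda>\<^sub>n\<^sub>+\<^sub>1 - r) / \<parallel>B\<parallel>) |y|\<^sub>D \<le> |x|\<^sub>D\<close> (\<open>eigenvector_contraction\<close>).  By the minimax principle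
  with the range of \<open>W\<close> as trial space, \<open>r\<close> exceeds \<open>\<lambda>\<^sub>n\<close> at most to second order in the
  distance of the ranges (\<open>eigenvalue_compressed_le\<close>), so the factor tends to the inverse of
  \<open>\<gamma> = \<parallel>B\<parallel> / (\<parallel>B\<parallel> + \<lambda>\<^sub>g)\<close>.

  Summing the squares over the \<open>n\<close> eigenvectors, and replacing \<open>D(W)\<close> by \<open>D(V)\<close> and the vectors \<open>w\<close>
  by the orthonormal columns of \<open>W\<close>, costs factors of the form \<open>1 + O(distance)\<close>
  (\<open>range_error_step\<close>).  The result is \<open>e\<^sub>k\<^sub>+\<^sub>1 \<le> \<gamma> (1 + C e\<^sub>k) e\<^sub>k\<close> for an error \<open>e\<^sub>k\<close> that is
  comparable with the spectral norm of \<open>P - P\<^sub>k\<close>.  As the \<open>e\<^sub>k\<close> then decay geometrically, the product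
  of the factors \<open>1 + C e\<^sub>k\<close> converges (\<open>perturbed_geometric_decay\<close>), and the rate \<open>\<gamma>\<close> is attained
  up to a constant.  The spectral theorem links eigenvectors to the sorted list of eigenvalues.
\<close>

section \<open>The complex inner product and adjoints\<close>

definition cinner :: "complex^'m \<Rightarrow> complex^'m \<Rightarrow> complex" where
  "cinner x y = (\<Sum>i\<in>UNIV. cnj (x $ i) * y $ i)"

lemma cinner_add_right: "cinner x (y + z) = cinner x y + cinner x z"
  and cinner_diff_right: "cinner x (y - z) = cinner x y - cinner x z"
  and cinner_smult_right: "cinner x (c *s y) = c * cinner x y"
  and cinner_smult_left: "cinner (c *s y) x = cnj c * cinner y x"
  and cinner_zero_right [simp]: "cinner x 0 = 0"
  and cinner_zero_left [simp]: "cinner 0 x = 0"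
  by (simp_all add: cinner_def algebra_simps sum.distrib sum_subtractf sum_distrib_left)

lemma cinner_sum_right: "cinner x (\<Sum>i\<in>I. f i) = (\<Sum>i\<in>I. cinner x (f i))"
  by (induction I rule: infinite_finite_induct) (simp_all add: cinner_add_right)

lemma cnj_cinner: "cnj (cinner x y) = cinner y x"
  by (simp add: cinner_def mult.commute)

lemma inner_eq_Re_cinner: "x \<bullet> y = Re (cinner x y)"
  by (simp add: cinner_def inner_vec_def inner_complex_def)

lemma cinner_self: "cinner x x = complex_of_real ((norm x)\<^sup>2)"
proof -
  have "cinner x x = complex_of_real (\<Sum>i\<in>UNIV. (cmod (x $ i))\<^sup>2)"
    unfolding cinner_def of_real_sum
    by (intro sum.cong refl) (simp only: complex_norm_square mult.commute)
  also have "(\<Sum>i\<in>UNIV. (cmod (x $ i))\<^sup>2) = (norm x)\<^sup>2"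
    by (simp add: norm_vec_def L2_set_def sum_nonneg)
  finally show ?thesis .
qed

lemma cinner_eqI: "(\<And>z. cinner z x = cinner z y) \<Longrightarrow> x = y"
  by (metis cinner_diff_right cinner_self diff_self norm_eq_zero of_real_eq_0_iff
      right_minus_eq zero_eq_power2)

lemma norm_smult: "norm (c *s x) = cmod c * norm (x :: complex^'m)"
proof -
  have "complex_of_real ((norm (c *s x))\<^sup>2) = complex_of_real ((cmod c * norm x)\<^sup>2)"
    by (simp only: cinner_self[symmetric] cinner_smult_left cinner_smult_right)
       (simp add: cinner_self power_mult_distrib complex_norm_square[symmetric] mult.assoc[symmetric]
         mult.commute[of "cnj c"] del: of_real_power)
  then have "(norm (c *s x))\<^sup>2 = (cmod c * norm x)\<^sup>2"
    using of_real_eq_iff by blast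
  then show ?thesis by simp
qed

lemma of_real_smult: "complex_of_real r *s x = r *\<^sub>R x"
  by (simp only: vec_eq_iff vector_smult_component vector_scaleR_component)
     (simp add: scaleR_conv_of_real)

lemma cinner_adj: "cinner (M *v x) y = cinner x (adj M *v y)"
proof -
  have "cinner (M *v x) y = (\<Sum>i\<in>UNIV. \<Sum>j\<in>UNIV. cnj (M $ i $ j) * cnj (x $ j) * y $ i)"
    by (simp add: cinner_def matrix_vector_mult_def sum_distrib_right)
  also have "\<dots> = (\<Sum>j\<in>UNIV. \<Sum>i\<in>UNIV. cnj (M $ i $ j) * cnj (x $ j) * y $ i)"
    by (rule sum.swap)
  also have "\<dots> = cinner x (adj M *v y)"
    by (simp add: cinner_def matrix_vector_mult_def adj_def sum_distrib_left mult_ac)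
  finally show ?thesis .
qed

lemma inner_adj: "(M *v x) \<bullet> y = x \<bullet> (adj M *v (y :: complex^'m))"
  by (simp add: inner_eq_Re_cinner cinner_adj)

lemma adj_adj [simp]: "adj (adj M) = M"
  by (simp add: adj_def vec_eq_iff)

lemma matrix_eqI: "(\<And>x. M *v x = N *v x) \<Longrightarrow> M = (N :: complex^'n^'m)"
  by (simp add: matrix_eq)

lemma adj_mult: "adj (M ** N) = adj N ** adj M"
  by (simp add: adj_def vec_eq_iff matrix_matrix_mult_def mult.commute)

lemma adj_add: "adj (M + N) = adj M + adj N"
  by (simp add: adj_def vec_eq_iff)

text \<open>A real-linear identity suffices for Hermitian symmetry, since all its instances on
  imaginary multiples are available as well.\<close>

lemma hermitianI:
  assumes "\<And>x y. x \<bullet> (M *v y) = (M *v x) \<bullet> (y :: complex^'m)"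
  shows "hermitian M"
proof -
  have "adj M *v y = M *v y" for y
  proof -
    have "x \<bullet> (adj M *v y - M *v y) = 0" for x
      using assms[of x y] by (simp add: inner_adj inner_diff_right)
    then show ?thesis
      by (metis inner_eq_zero_iff right_minus_eq)
  qed
  then show ?thesis
    unfolding hermitian_def by (rule matrix_eqI)
qed

lemma hermitian_inner: "hermitian M \<Longrightarrow> (M *v x) \<bullet> y = x \<bullet> (M *v y)"
  and hermitian_cinner: "hermitian M \<Longrightarrow> cinner (M *v x) y = cinner x (M *v y)"
  by (simp_all add: hermitian_def inner_adj cinner_adj)

lemma matrix_vector_smult: "M *v (c *s x) = c *s (M *v (x :: complex^'n))"
  by (simp add: vec_eq_iff matrix_vector_mult_def sum_distrib_left mult_ac)

lemma matrix_vector_scaleR: "M *v (r *\<^sub>R x) = r *\<^sub>R (M *v (x :: complex^'n))"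
  by (metis matrix_vector_smult of_real_smult)

lemma norm_matrix_vector_le: "norm (M *v x) \<le> spectral_norm M * norm x"
  unfolding spectral_norm_def by (rule onorm) simp

lemma spectral_norm_nonneg: "0 \<le> spectral_norm M"
  unfolding spectral_norm_def by (rule onorm_pos_le) simp

section \<open>Isometries and their projectors\<close>

lemma adj_mult_vector_nth: "(adj V *v x) $ i = cinner (column i V) x"
  by (simp add: adj_def matrix_vector_mult_def cinner_def column_def)

lemma matrix_vector_eq_column_sum: "V *v c = (\<Sum>i\<in>UNIV. (c $ i) *s column i (V :: complex^'n^'m))"
  by (auto simp add: vec_eq_iff matrix_vector_mult_def column_def intro!: sum.cong mult.commute)

lemma column_eq: "column i V = V *v axis i (1 :: complex)"
  by (simp add: matrix_vector_eq_column_sum axis_def if_distrib[of "\<lambda>c. c *s _"] cong: if_cong)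

lemma orthonormal_columns_iff:
  "orthonormal_columns V \<longleftrightarrow>
    (\<forall>i j. cinner (column i V) (column j V) = (if i = j then 1 else 0))"
  by (auto simp add: orthonormal_columns_def vec_eq_iff mat_def matrix_matrix_mult_def adj_def
      cinner_def column_def)

lemma adj_isometry: "orthonormal_columns V \<Longrightarrow> adj V *v (V *v c) = c"
  by (simp add: orthonormal_columns_def matrix_vector_mul_assoc)

lemma norm_isometry:
  assumes "orthonormal_columns V" shows "norm (V *v c) = norm c"
proof -
  have "(V *v c) \<bullet> (V *v c) = c \<bullet> c"
    using assms by (simp add: inner_adj adj_isometry)
  then show ?thesis by (simp add: norm_eq_sqrt_inner)
qed

lemma norm_column: "orthonormal_columns V \<Longrightarrow> norm (column i V) = 1"
  by (simp add: column_eq norm_isometry norm_axis_1)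

lemma col_projector_vector: "col_projector V *v x = V *v (adj V *v x)"
  by (simp add: col_projector_def matrix_vector_mul_assoc)

lemma col_projector_sum:
  "col_projector V *v x = (\<Sum>i\<in>UNIV. cinner (column i V) x *s column i V)"
  by (simp add: col_projector_vector matrix_vector_eq_column_sum[of V] adj_mult_vector_nth)

lemma hermitian_col_projector: "hermitian (col_projector V)"
  by (simp add: hermitian_def col_projector_def adj_mult)

lemma col_projector_isometry:
  "orthonormal_columns V \<Longrightarrow> col_projector V *v (V *v c) = V *v c"
  by (simp add: col_projector_vector adj_isometry)

lemma col_projector_column:
  "orthonormal_columns V \<Longrightarrow> col_projector V *v column i V = column i V"
  by (simp add: column_eq col_projector_isometry)

lemma col_projector_idem:
  "orthonormal_columns V \<Longrightarrow> col_projector V *v (col_projector V *v x) = col_projector V *v x"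
  by (simp add: col_projector_vector adj_isometry)

lemma norm_col_projector_sq:
  assumes "orthonormal_columns V"
  shows "(norm (col_projector V *v x))\<^sup>2 = (\<Sum>i\<in>UNIV. (cmod (cinner (column i V) x))\<^sup>2)"
proof -
  have "norm (col_projector V *v x) = norm (adj V *v x)"
    by (simp add: col_projector_vector norm_isometry assms)
  then show ?thesis
    by (simp add: norm_vec_def L2_set_def sum_nonneg adj_mult_vector_nth)
qed

lemma col_projector_orthogonal:
  assumes "orthonormal_columns V"
  shows "(col_projector V *v x) \<bullet> (y - col_projector V *v y) = 0"
  by (simp add: hermitian_inner[OF hermitian_col_projector] matrix_vector_mult_diff_distrib
      col_projector_idem assms)

lemma norm_col_projector_pythagoras:
  assumes "orthonormal_columns V"
  shows "(norm x)\<^sup>2 = (norm (col_projector V *v x))\<^sup>2 + (norm (x - col_projector V *v x))\<^sup>2"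
proof -
  have "(col_projector V *v x) \<bullet> (x - col_projector V *v x) = 0"
    by (rule col_projector_orthogonal[OF assms])
  then show ?thesis
    by (simp add: power2_norm_eq_inner inner_diff_left inner_diff_right inner_commute)
qed

lemma norm_col_projector_le:
  assumes "orthonormal_columns V"
  shows "norm (col_projector V *v x) \<le> norm x"
proof (rule power2_le_imp_le)
  show "(norm (col_projector V *v x))\<^sup>2 \<le> (norm x)\<^sup>2"
    using norm_col_projector_pythagoras[OF assms, of x] by (simp add: power2_eq_square)
qed simp

section \<open>Positive semidefinite forms\<close>

text \<open>The Cauchy--Schwarz inequality is needed on a subspace in the spectral theorem, and on the
  whole space for the energy seminorms below.\<close>

lemma psd_Cauchy_Schwarz:
  fixes T :: "'a::real_inner \<Rightarrow> 'a"
  assumes "linear T" "subspace S" "x \<in> S" "y \<in> S"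
    and sym: "\<And>x y. T x \<bullet> y = x \<bullet> T y"
    and psd: "\<And>z. z \<in> S \<Longrightarrow> 0 \<le> z \<bullet> T z"
  shows "(x \<bullet> T y)\<^sup>2 \<le> (x \<bullet> T x) * (y \<bullet> T y)"
proof -
  interpret linear T by fact
  have sym': "y \<bullet> T x = x \<bullet> T y"
    by (metis sym inner_commute)
  have pos: "0 \<le> s\<^sup>2 * (x \<bullet> T x) - 2 * s * t * (x \<bullet> T y) + t\<^sup>2 * (y \<bullet> T y)" for s t
  proof -
    have "s *\<^sub>R x - t *\<^sub>R y \<in> S"
      by (intro subspace_diff subspace_scale assms)
    from psd[OF this] show ?thesis
      by (simp add: diff scaleR inner_diff_left inner_diff_right sym' power2_eq_square algebra_simps)
  qed
  show ?thesis
  proof (cases "y \<bullet> T y = 0")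
    case False
    then have "0 < y \<bullet> T y"
      using psd[OF assms(4)] by simp
    moreover have "0 \<le> (y \<bullet> T y) * ((x \<bullet> T x) * (y \<bullet> T y) - (x \<bullet> T y)\<^sup>2)"
      using pos[of "y \<bullet> T y" "x \<bullet> T y"] by (simp add: power2_eq_square algebra_simps)
    ultimately show ?thesis
      by (simp add: zero_le_mult_iff)
  next
    case True
    have "x \<bullet> T y = 0"
    proof (rule ccontr)
      assume "x \<bullet> T y \<noteq> 0"
      then show False
        using pos[of 1 "(x \<bullet> T x + 1) / (2 * (x \<bullet> T y))"] True by simp
    qed
    then show ?thesis by (simp add: True)
  qed
qed

section \<open>The spectral theorem and the list of eigenvalues\<close>

definition orthonormal_set :: "(complex^'m) set \<Rightarrow> bool" where
  "orthonormal_set F \<longleftrightarrow> (\<forall>f\<in>F. \<forall>g\<in>F. cinner f g = (if f = g then 1 else 0))"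

lemma cinner_orthonormal_sum:
  assumes "orthonormal_set F" "finite F" "g \<in> F"
  shows "cinner g (\<Sum>f\<in>F. c f *s f) = c g"
proof -
  have "cinner g (\<Sum>f\<in>F. c f *s f) = (\<Sum>f\<in>F. if g = f then c f else 0)"
    unfolding cinner_sum_right
    by (intro sum.cong refl) (use assms in \<open>auto simp: cinner_smult_right orthonormal_set_def\<close>)
  then show ?thesis using assms by simp
qed

lemma orthonormal_set_independent:
  assumes "orthonormal_set F" shows "vec.independent F"
  unfolding vec.independent_explicit_finite_subsets
proof (intro allI impI ballI)
  fix S u v
  assume S: "S \<subseteq> F" "finite S" "(\<Sum>f\<in>S. u f *s f) = 0" "v \<in> S"
  then have "orthonormal_set S"
    using assms by (auto simp: orthonormal_set_def subset_iff)
  then show "u v = 0"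
    using cinner_orthonormal_sum[of S v u] S by simp
qed

lemma orthonormal_set_card:
  fixes F :: "(complex^'m) set"
  assumes "orthonormal_set F" shows "finite F" "card F \<le> CARD('m)"
  using orthonormal_set_independent[OF assms] vec.finiteI_independent
    vec.independent_card_le_dim[of F UNIV] by (auto simp: card_cart_basis)

text \<open>A maximizer of the Rayleigh quotient on an invariant subspace is an eigenvector: the form
  \<open>r |z|\<^sup>2 - z\<^sup>* M z\<close> is nonnegative there and vanishes at the maximizer, so by Cauchy--Schwarz it
  pairs to zero with everything.\<close>

lemma hermitian_eigenvector_in_subspace:
  fixes M :: "complex^'m^'m"
  assumes M: "hermitian M" and S: "subspace S" and inv: "\<And>x. x \<in> S \<Longrightarrow> M *v x \<in> S"
    and nz: "x0 \<in> S" "x0 \<noteq> 0"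
  obtains r x where "x \<in> S" "norm x = 1" "M *v x = complex_of_real r *s x"
proof -
  have "compact (S \<inter> sphere 0 1)"
    by (rule closed_Int_compact[OF closed_subspace[OF S] compact_sphere])
  moreover have "inverse (norm x0) *\<^sub>R x0 \<in> S \<inter> sphere 0 1"
    using nz S by (auto intro: subspace_scale)
  moreover have "continuous_on (S \<inter> sphere 0 1) (\<lambda>x. x \<bullet> (M *v x))"
    by (intro continuous_intros linear_continuous_on matrix_vector_mul_bounded_linear)
  ultimately obtain x where x: "x \<in> S \<inter> sphere 0 1"
    and max: "\<And>y. y \<in> S \<inter> sphere 0 1 \<Longrightarrow> y \<bullet> (M *v y) \<le> x \<bullet> (M *v x)"
    by (metis (no_types, lifting) continuous_attains_sup empty_iff)
  define r where "r = x \<bullet> (M *v x)"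
  define T where "T z = r *\<^sub>R z - M *v z" for z
  have T: "linear T"
    unfolding T_def by (intro linear_compose_sub linear_scale_self matrix_vector_mul_linear)
  have sym: "T u \<bullet> v = u \<bullet> T v" for u v
    by (simp add: T_def inner_diff_left inner_diff_right hermitian_inner[OF M])
  have psd: "0 \<le> z \<bullet> T z" if "z \<in> S" for z
  proof (cases "z = 0")
    case False
    have "inverse (norm z) *\<^sub>R z \<in> S \<inter> sphere 0 1"
      using False that S by (auto intro: subspace_scale)
    from max[OF this] have "inverse (norm z) * (inverse (norm z) * (z \<bullet> (M *v z))) \<le> r"
      by (simp add: r_def matrix_vector_scaleR)
    then have "z \<bullet> (M *v z) \<le> r * (norm z)\<^sup>2"
      using False by (simp add: field_simps power2_eq_square)
    then show ?thesis
      by (simp add: T_def inner_diff_right power2_norm_eq_inner)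
  qed simp
  have Tx: "x \<bullet> T x = 0"
    using x by (simp add: T_def r_def inner_diff_right power2_norm_eq_inner[symmetric])
  have TxS: "T x \<in> S"
    unfolding T_def using x S inv by (auto intro: subspace_diff subspace_scale)
  have "(T x \<bullet> T x)\<^sup>2 \<le> (T x \<bullet> T (T x)) * (x \<bullet> T x)"
    by (rule psd_Cauchy_Schwarz[OF T S TxS _ sym psd]) (use x in auto)
  then have "T x = 0" by (simp add: Tx)
  then have "M *v x = complex_of_real r *s x"
    by (simp add: T_def of_real_smult)
  then show ?thesis using that x by auto
qed

lemma cinner_orthonormal_remainder:
  assumes "orthonormal_set F" "f \<in> F"
  shows "cinner f (x - (\<Sum>g\<in>F. cinner g x *s g)) = 0"
  using assms by (simp add: cinner_diff_right cinner_orthonormal_sum orthonormal_set_card)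

text \<open>A largest orthonormal set of eigenvectors is a basis, since its orthogonal complement is
  invariant and would contain a further eigenvector.\<close>

theorem hermitian_eigenvector_basis:
  fixes M :: "complex^'m^'m"
  assumes M: "hermitian M"
  obtains F \<mu> where "orthonormal_set F" "card F = CARD('m)"
    "\<And>f. f \<in> F \<Longrightarrow> M *v f = complex_of_real (\<mu> f) *s f"
    "\<And>x. x = (\<Sum>f\<in>F. cinner f x *s f)"
proof -
  define Q where "Q F \<longleftrightarrow> orthonormal_set F \<and>
      (\<forall>f\<in>F. \<exists>r. M *v f = complex_of_real r *s f)" for F
  have "Q {}" by (simp add: Q_def orthonormal_set_def)
  moreover have "\<And>F. Q F \<Longrightarrow> card F \<le> CARD('m)"
    by (simp add: Q_def orthonormal_set_card)
  ultimately obtain F where F: "Q F" and max: "\<And>G. Q G \<Longrightarrow> card G \<le> card F"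
    using ex_has_greatest_nat[of Q "{}" card "Suc (CARD('m))"] by (metis le_imp_less_Suc)
  have orth: "orthonormal_set F" using F by (simp add: Q_def)
  define S where "S = {x. \<forall>f\<in>F. cinner f x = 0}"
  have "subspace S"
    by (auto simp: S_def subspace_def cinner_add_right of_real_smult[symmetric] cinner_smult_right)
  moreover have "M *v x \<in> S" if "x \<in> S" for x
    unfolding S_def
  proof (intro CollectI ballI)
    fix f assume "f \<in> F"
    then have "cinner (M *v f) x = 0"
      using F that unfolding Q_def S_def
      by (metis (mono_tags, lifting) cinner_smult_left mem_Collect_eq mult_zero_right)
    then show "cinner f (M *v x) = 0"
      by (simp add: hermitian_cinner[OF M])
  qed
  ultimately have S0: "x = 0" if "x \<in> S" for x
  proof (rule_tac ccontr)
    assume "subspace S" "\<And>x. x \<in> S \<Longrightarrow> M *v x \<in> S" "x \<noteq> 0"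
    from hermitian_eigenvector_in_subspace[OF M this(1,2) \<open>x \<in> S\<close> this(3)]
    obtain r v where v: "v \<in> S" "norm v = 1" "M *v v = complex_of_real r *s v" by metis
    have "cinner v v = 1" using v by (simp add: cinner_self)
    then have "v \<notin> F" using v(1) by (auto simp: S_def)
    have "cinner f v = 0 \<and> cinner v f = 0" if "f \<in> F" for f
      using v(1) that cnj_cinner[of f v] by (auto simp: S_def)
    then have "orthonormal_set (insert v F)"
      using orth \<open>v \<notin> F\<close> \<open>cinner v v = 1\<close> unfolding orthonormal_set_def
      by auto
    with F v have "Q (insert v F)"
      by (auto simp: Q_def)
    from max[OF this] show False
      using \<open>v \<notin> F\<close> orthonormal_set_card(1)[OF orth] by simp
  qed
  have exp: "x = (\<Sum>f\<in>F. cinner f x *s f)" for x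
    using S0[of "x - (\<Sum>f\<in>F. cinner f x *s f)"] cinner_orthonormal_remainder[OF orth]
    by (simp add: S_def)
  have "vec.span F = UNIV"
    by (metis (no_types, lifting) UNIV_eq_I exp vec.span_base vec.span_scale vec.span_sum)
  then have "card F = CARD('m)"
    using vec.dim_span_eq_card_independent[OF orthonormal_set_independent[OF orth]]
    by (simp add: card_cart_basis)
  moreover obtain \<mu> where "\<And>f. f \<in> F \<Longrightarrow> M *v f = complex_of_real (\<mu> f) *s f"
    using F unfolding Q_def by metis
  ultimately show ?thesis
    using that[OF orth _ _ exp] by blast
qed

text \<open>An orthonormal basis of eigenvectors splits into bases of the eigenspaces; so the multiplicities
  in \<^const>\<open>eigenvalues\<close> can be counted in any such basis.\<close>

lemma eigenspace_eq_span:
  assumes orth: "orthonormal_set F" and eig: "\<And>f. f \<in> F \<Longrightarrow> M *v f = complex_of_real (\<mu> f) *s f"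
    and exp: "\<And>x. x = (\<Sum>f\<in>F. cinner f x *s f)"
  shows "eigenspace M r = vec.span {f\<in>F. \<mu> f = r}"
proof (intro set_eqI iffI)
  have fin: "finite F" by (rule orthonormal_set_card(1)[OF orth])
  fix x assume "x \<in> eigenspace M r"
  then have Mx: "M *v x = complex_of_real r *s x" by (simp add: eigenspace_def)
  have "M *v x = (\<Sum>f\<in>F. (complex_of_real (\<mu> f) * cinner f x) *s f)"
  proof -
    have "M *v x = M *v (\<Sum>f\<in>F. cinner f x *s f)"
      using exp[of x] by (rule arg_cong)
    also have "\<dots> = (\<Sum>f\<in>F. (complex_of_real (\<mu> f) * cinner f x) *s f)"
      by (auto simp: vec.linear_sum[OF matrix_vector_mul_linear_gen] matrix_vector_smult eig
          mult.commute intro!: sum.cong)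
    finally show ?thesis .
  qed
  then have "complex_of_real (\<mu> g) * cinner g x = complex_of_real r * cinner g x" if "g \<in> F" for g
    using cinner_orthonormal_sum[OF orth fin that, of "\<lambda>f. complex_of_real (\<mu> f) * cinner f x"] Mx
    by (metis cinner_smult_right)
  then have zero: "cinner g x = 0" if "g \<in> F" "\<mu> g \<noteq> r" for g
    using that by auto
  have "x = (\<Sum>f\<in>F. cinner f x *s f)" by (rule exp)
  also have "\<dots> = (\<Sum>f\<in>{f\<in>F. \<mu> f = r}. cinner f x *s f)"
    by (rule sum.mono_neutral_right) (auto simp: fin zero)
  also have "\<dots> \<in> vec.span {f\<in>F. \<mu> f = r}"
    by (intro vec.span_sum vec.span_scale vec.span_base)
  finally show "x \<in> vec.span {f\<in>F. \<mu> f = r}" .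
next
  have "vec.subspace (eigenspace M r)"
    by (auto simp: eigenspace_def vec.subspace_def matrix_vector_right_distrib matrix_vector_smult
        vector_add_ldistrib vector_smult_assoc mult.commute)
  moreover have "{f\<in>F. \<mu> f = r} \<subseteq> eigenspace M r"
    using eig by (auto simp: eigenspace_def)
  ultimately show "x \<in> eigenspace M r" if "x \<in> vec.span {f\<in>F. \<mu> f = r}" for x
    using that vec.span_minimal by blast
qed

lemma dim_eigenspace:
  assumes "orthonormal_set F" "\<And>f. f \<in> F \<Longrightarrow> M *v f = complex_of_real (\<mu> f) *s f"
    and "\<And>x. x = (\<Sum>f\<in>F. cinner f x *s f)"
  shows "vec.dim (eigenspace M r) = card {f\<in>F. \<mu> f = r}"
proof -
  have "orthonormal_set {f\<in>F. \<mu> f = r}"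
    using assms(1) by (auto simp: orthonormal_set_def)
  moreover have "eigenspace M r = vec.span {f\<in>F. \<mu> f = r}"
    by (rule eigenspace_eq_span[OF assms])
  ultimately show ?thesis
    using vec.dim_span_eq_card_independent orthonormal_set_independent by metis
qed

lemma mset_eigenvalues:
  assumes "orthonormal_set F" "\<And>f. f \<in> F \<Longrightarrow> M *v f = complex_of_real (\<mu> f) *s f"
    and "\<And>x. x = (\<Sum>f\<in>F. cinner f x *s f)"
  shows "mset (eigenvalues M) = image_mset \<mu> (mset_set F)"
proof -
  have fin: "finite F" by (rule orthonormal_set_card(1)[OF assms(1)])
  have dim: "vec.dim (eigenspace M r) = card {f\<in>F. \<mu> f = r}" for r
    by (rule dim_eigenspace[OF assms])
  have "eigenspace M r \<noteq> {0} \<longleftrightarrow> r \<in> \<mu> ` F" for r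
  proof -
    have "0 \<in> eigenspace M r" by (simp add: eigenspace_def)
    then have "eigenspace M r = {0} \<longleftrightarrow> vec.dim (eigenspace M r) = 0"
      using vec.dim_eq_0[of "eigenspace M r"] by auto
    then show ?thesis using fin by (auto simp: dim)
  qed
  then have "{r. eigenspace M r \<noteq> {0}} = \<mu> ` F" by auto
  then have "mset (eigenvalues M) = (\<Sum>r\<in>\<mu> ` F. replicate_mset (card {f\<in>F. \<mu> f = r}) r)"
    by (simp add: eigenvalues_def dim)
  also have "\<dots> = image_mset \<mu> (mset_set F)"
  proof (rule multiset_eqI)
    fix r
    have "count (\<Sum>r\<in>\<mu> ` F. replicate_mset (card {f\<in>F. \<mu> f = r}) r) r
        = (\<Sum>s\<in>\<mu> ` F. if s = r then card {f\<in>F. \<mu> f = s} else 0)"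
      by (auto simp: count_sum intro!: sum.cong)
    also have "\<dots> = card {f\<in>F. \<mu> f = r}"
      using fin by (auto simp: card_eq_0_iff)
    also have "\<dots> = count (image_mset \<mu> (mset_set F)) r"
      using fin by (simp add: count_image_mset_eq_card_vimage)
    finally show "count (\<Sum>r\<in>\<mu> ` F. replicate_mset (card {f\<in>F. \<mu> f = r}) r) r
        = count (image_mset \<mu> (mset_set F)) r" .
  qed
  finally show ?thesis .
qed

text \<open>The index ties each basis vector to a position in the sorted list of eigenvalues,
  counting multiplicities.\<close>

definition eigenbasis :: "complex^'m^'m \<Rightarrow> (nat \<Rightarrow> complex^'m) \<Rightarrow> bool" where
  "eigenbasis M f \<longleftrightarrow>
     (\<forall>i<CARD('m). \<forall>j<CARD('m). cinner (f i) (f j) = (if i = j then 1 else 0)) \<and>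
     (\<forall>j<CARD('m). M *v f j = complex_of_real (eigenvalues M ! j) *s f j) \<and>
     (\<forall>x. x = (\<Sum>j<CARD('m). cinner (f j) x *s f j))"

lemma sorted_eigenvalues: "sorted (eigenvalues M)"
  by (simp add: eigenvalues_def)

theorem hermitian_eigenbasis:
  fixes M :: "complex^'m^'m"
  assumes M: "hermitian M"
  obtains f where "eigenbasis M f" and "length (eigenvalues M) = CARD('m)"
proof -
  obtain F \<mu> where F: "orthonormal_set F" "card F = CARD('m)"
    "\<And>f. f \<in> F \<Longrightarrow> M *v f = complex_of_real (\<mu> f) *s f"
    "\<And>x. x = (\<Sum>f\<in>F. cinner f x *s f)"
    by (rule hermitian_eigenvector_basis[OF M]) (rule that)
  have fin: "finite F" by (rule orthonormal_set_card(1)[OF F(1)])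
  have ms: "mset (eigenvalues M) = image_mset \<mu> (mset_set F)"
    by (rule mset_eigenvalues[OF F(1,3,4)])
  obtain xs where xs: "set xs = F" "distinct xs"
    using finite_distinct_list[OF fin] by auto
  define fs where "fs = sort_key \<mu> xs"
  have fs: "set fs = F" "distinct fs" "length fs = CARD('m)"
    using xs F(2) by (auto simp: fs_def distinct_card[symmetric])
  have "mset (map \<mu> fs) = mset (eigenvalues M)"
    using fs by (simp add: ms mset_set_set[symmetric])
  moreover have "sorted (map \<mu> fs)" by (simp add: fs_def)
  ultimately have ev: "map \<mu> fs = eigenvalues M"
    using sorted_eigenvalues[of M] by (metis properties_for_sort sorted_sort_id)
  have bij: "bij_betw ((!) fs) {..<CARD('m)} F"
    using fs by (intro bij_betw_nth) auto
  have "eigenbasis M ((!) fs)"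
    unfolding eigenbasis_def
  proof (intro conjI allI impI)
    fix x
    have "x = (\<Sum>f\<in>F. cinner f x *s f)" by (rule F(4))
    also have "\<dots> = (\<Sum>j<CARD('m). cinner (fs ! j) x *s fs ! j)"
      by (rule sum.reindex_bij_betw[OF bij, symmetric])
    finally show "x = (\<Sum>j<CARD('m). cinner (fs ! j) x *s fs ! j)" .
  next
    fix i j assume "i < CARD('m)" "j < CARD('m)"
    then show "cinner (fs ! i) (fs ! j) = (if i = j then 1 else 0)"
      using F(1) fs by (auto simp: orthonormal_set_def nth_eq_iff_index_eq)
  next
    fix j assume "j < CARD('m)"
    then show "M *v fs ! j = complex_of_real (eigenvalues M ! j) *s fs ! j"
      using F(3)[of "fs ! j"] fs nth_mem[of j fs] by (simp add: ev[symmetric])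
  qed
  moreover have "length (eigenvalues M) = CARD('m)"
    using fs by (simp add: ev[symmetric])
  ultimately show ?thesis using that by blast
qed

context
  fixes M :: "complex^'m^'m" and f :: "nat \<Rightarrow> complex^'m"
  assumes basis: "eigenbasis M f"
begin

lemma eigenbasis_orthonormal:
  "i < CARD('m) \<Longrightarrow> j < CARD('m) \<Longrightarrow> cinner (f i) (f j) = (if i = j then 1 else 0)"
  and eigenbasis_eigenvector:
  "j < CARD('m) \<Longrightarrow> M *v f j = complex_of_real (eigenvalues M ! j) *s f j"
  and eigenbasis_expansion: "x = (\<Sum>j<CARD('m). cinner (f j) x *s f j)"
  using basis unfolding eigenbasis_def by blast+

lemma eigenbasis_norm: "j < CARD('m) \<Longrightarrow> norm (f j) = 1"
  using eigenbasis_orthonormal[of j j] cinner_self[of "f j"]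
  by (metis norm_ge_zero of_real_eq_1_iff power2_eq_1_iff abs_norm_cancel abs_if zero_neq_neg_one
      neg_0_le_iff_le not_one_le_zero)

lemma eigenbasis_cinner:
  "cinner x y = (\<Sum>j<CARD('m). cnj (cinner (f j) x) * cinner (f j) y)"
proof -
  have "cinner x y = cinner x (\<Sum>j<CARD('m). cinner (f j) y *s f j)"
    using eigenbasis_expansion[of y] by (rule arg_cong)
  also have "\<dots> = (\<Sum>j<CARD('m). cnj (cinner (f j) x) * cinner (f j) y)"
    by (simp add: cinner_sum_right cinner_smult_right cnj_cinner mult.commute)
  finally show ?thesis .
qed

lemma eigenbasis_norm_sq: "(norm x)\<^sup>2 = (\<Sum>j<CARD('m). (cmod (cinner (f j) x))\<^sup>2)"
proof -
  have "complex_of_real ((norm x)\<^sup>2) = complex_of_real (\<Sum>j<CARD('m). (cmod (cinner (f j) x))\<^sup>2)"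
    unfolding cinner_self[symmetric] eigenbasis_cinner[of x x] of_real_sum
    by (intro sum.cong refl) (simp only: complex_norm_square mult.commute)
  then show ?thesis by (simp only: of_real_eq_iff)
qed

lemma eigenbasis_form:
  assumes M: "hermitian M"
  shows "x \<bullet> (M *v x) = (\<Sum>j<CARD('m). eigenvalues M ! j * (cmod (cinner (f j) x))\<^sup>2)"
proof -
  have "cinner x (M *v x) = complex_of_real (\<Sum>j<CARD('m). eigenvalues M ! j * (cmod (cinner (f j) x))\<^sup>2)"
    unfolding eigenbasis_cinner[of x "M *v x"] of_real_sum
  proof (intro sum.cong refl)
    fix j assume "j \<in> {..<CARD('m)}"
    then have "cinner (f j) (M *v x) = complex_of_real (eigenvalues M ! j) * cinner (f j) x"
      by (simp add: hermitian_cinner[OF M, symmetric] eigenbasis_eigenvector cinner_smult_left)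
    then show "cnj (cinner (f j) x) * cinner (f j) (M *v x) =
        complex_of_real (eigenvalues M ! j * (cmod (cinner (f j) x))\<^sup>2)"
      by (simp add: complex_norm_square mult_ac del: of_real_power)
  qed
  then show ?thesis by (simp add: inner_eq_Re_cinner del: of_real_sum of_real_mult)
qed

end

lemma hermitian_eigenvectors_orthogonal:
  assumes M: "hermitian M" and u: "M *v u = complex_of_real a *s u"
    and v: "M *v v = complex_of_real b *s v" and "a \<noteq> b"
  shows "cinner u v = 0"
proof -
  have "complex_of_real a * cinner u v = complex_of_real b * cinner u v"
    using hermitian_cinner[OF M, of u v] by (simp add: u v cinner_smult_left cinner_smult_right)
  then show ?thesis using \<open>a \<noteq> b\<close> by simp
qed

section \<open>Enumerating the columns\<close>

lemma col_index_less: "i < j \<Longrightarrow> col_index i < col_index (j :: 'n::{finite,linorder})"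
  unfolding col_index_def by (rule psubset_card_mono) (auto dest: less_trans)

lemma col_index_lt_card: "col_index (i :: 'n::{finite,linorder}) < CARD('n)"
  unfolding col_index_def by (rule psubset_card_mono) auto

lemma inj_col_index: "inj (col_index :: 'n::{finite,linorder} \<Rightarrow> nat)"
  by (rule injI) (metis col_index_less less_irrefl linorder_neqE)

lemma bij_col_index: "bij_betw col_index (UNIV :: 'n::{finite,linorder} set) {..<CARD('n)}"
proof -
  have "col_index ` (UNIV :: 'n set) = {..<CARD('n)}"
    by (rule card_subset_eq) (auto simp: col_index_lt_card card_image inj_col_index)
  then show ?thesis by (simp add: bij_betw_def inj_col_index)
qed

lemma col_index_surj: "j < CARD('n::{finite,linorder}) \<Longrightarrow> \<exists>i :: 'n. col_index i = j"
  using bij_col_index unfolding bij_betw_def by (metis imageE lessThan_iff)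

lemma enumeration_col_index: "sorted_list_of_set UNIV ! col_index i = (i :: 'n::{finite,linorder})"
proof -
  define l where "l = sorted_list_of_set (UNIV :: 'n set)"
  have l: "set l = UNIV" "distinct l" "sorted l" "sorted_wrt (<) l"
    by (simp_all add: l_def)
  obtain p where p: "p < length l" "l ! p = i"
    using l(1) by (metis UNIV_I in_set_conv_nth)
  have "{j. j < i} = (!) l ` {..<p}"
  proof (intro set_eqI iffI)
    fix j assume "j \<in> {j. j < i}"
    moreover obtain q where "q < length l" "l ! q = j"
      using l(1) by (metis UNIV_I in_set_conv_nth)
    ultimately have "q < p"
      using p l(3) by (metis linorder_not_less mem_Collect_eq sorted_nth_mono)
    with \<open>l ! q = j\<close> show "j \<in> (!) l ` {..<p}" by auto
  next
    fix j assume "j \<in> (!) l ` {..<p}"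
    then show "j \<in> {j. j < i}"
      using p l(4) by (auto simp: sorted_wrt_iff_nth_less)
  qed
  moreover have "inj_on ((!) l) {..<p}"
    using p l(2) by (auto simp: inj_on_def nth_eq_iff_index_eq)
  ultimately have "col_index i = p"
    by (simp add: col_index_def card_image)
  then show ?thesis using p by (simp add: l_def)
qed

section \<open>Lowest eigenvectors\<close>

lemma lowest_eigenvectors_exist:
  fixes M :: "complex^'m^'m"
  assumes "hermitian M" "CARD('n) \<le> CARD('m)"
  shows "\<exists>V :: complex^('n::{finite,linorder})^'m. lowest_eigenvectors M V"
proof -
  obtain f where f: "eigenbasis M f"
    using hermitian_eigenbasis[OF assms(1)] by blast
  define V :: "complex^('n::{finite,linorder})^'m" where "V = (\<chi> r i. f (col_index i) $ r)"
  have col: "column i V = f (col_index i)" for i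
    by (simp add: V_def column_def)
  have lt: "col_index i < CARD('m)" for i :: 'n
    using col_index_lt_card[of i] assms(2) by simp
  have "lowest_eigenvectors M V"
    unfolding lowest_eigenvectors_def orthonormal_columns_iff col
    using eigenbasis_orthonormal[OF f lt lt] eigenbasis_eigenvector[OF f lt]
    by (auto dest: injD[OF inj_col_index])
  then show ?thesis by blast
qed

text \<open>The minimax principle: \<open>n\<close> dimensions always contain a vector orthogonal to the \<open>n - 1\<close>
  lowest members of an eigenbasis.\<close>

lemma eigenvalue_le_form:
  fixes M :: "complex^'m^'m" and W :: "complex^('n::{finite,linorder})^'m"
  assumes M: "hermitian M" and W: "orthonormal_columns W" and nm: "CARD('n) \<le> CARD('m)"
    and h: "\<And>c. (W *v c) \<bullet> (M *v (W *v c)) \<le> h * (norm c)\<^sup>2"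
  shows "eigenvalues M ! (CARD('n) - 1) \<le> h"
proof -
  obtain f where f: "eigenbasis M f" and len: "length (eigenvalues M) = CARD('m)"
    using hermitian_eigenbasis[OF M] by blast
  define n where "n = CARD('n)"
  have n0: "n > 0" by (simp add: n_def)
  \<comment> \<open>The row of the largest index is zero, so \<open>T\<close> is singular; a kernel vector is orthogonal to the
    other \<open>n - 1\<close> eigenvectors.\<close>
  define T :: "complex^('n::{finite,linorder})^('n::{finite,linorder})" where
    "T = (\<chi> i j. if col_index i < n - 1 then cinner (f (col_index i)) (column j W) else 0)"
  have T: "(T *v c) $ i = (if col_index i < n - 1 then cinner (f (col_index i)) (W *v c) else 0)" for c i
  proof -
    have "cinner u (W *v c) = (\<Sum>j\<in>UNIV. cinner u (column j W) * c $ j)" for u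
      by (simp add: matrix_vector_eq_column_sum[of W] cinner_sum_right cinner_smult_right mult.commute)
    moreover have "(T *v c) $ i = (\<Sum>j\<in>UNIV. T $ i $ j * c $ j)"
      by (simp add: matrix_vector_mult_def)
    ultimately show ?thesis by (simp add: T_def)
  qed
  obtain i0 :: 'n where i0: "col_index i0 = n - 1"
    using col_index_surj[where 'n='n, of "n - 1"] n0 by (auto simp: n_def)
  have "T ** S \<noteq> mat 1" for S
  proof
    assume "T ** S = mat 1"
    then have "T *v (S *v axis i0 1) = axis i0 1"
      by (simp add: matrix_vector_mul_assoc)
    then have "(T *v (S *v axis i0 1)) $ i0 = 1" by simp
    then show False using T[of "S *v axis i0 1" i0] i0 by simp
  qed
  then have "\<not> (\<exists>S. S ** T = mat 1)"
    using matrix_left_right_inverse by blast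
  then obtain c where c: "T *v c = 0" "c \<noteq> 0"
    unfolding matrix_left_invertible_ker by blast
  define x where "x = W *v c"
  have zero: "cinner (f j) x = 0" if "j < n - 1" for j
  proof -
    have "j < CARD('n)" using that by (simp add: n_def)
    then obtain i :: 'n where "col_index i = j"
      using col_index_surj by blast
    then show ?thesis using T[of c i] c that by (simp add: x_def)
  qed
  have nx: "norm x = norm c" by (simp add: x_def norm_isometry[OF W])
  have "eigenvalues M ! (n - 1) * (norm x)\<^sup>2
      = (\<Sum>j<CARD('m). eigenvalues M ! (n - 1) * (cmod (cinner (f j) x))\<^sup>2)"
    by (simp add: eigenbasis_norm_sq[OF f] sum_distrib_left)
  also have "\<dots> \<le> (\<Sum>j<CARD('m). eigenvalues M ! j * (cmod (cinner (f j) x))\<^sup>2)"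
  proof (rule sum_mono)
    fix j assume j: "j \<in> {..<CARD('m)}"
    show "eigenvalues M ! (n - 1) * (cmod (cinner (f j) x))\<^sup>2 \<le> eigenvalues M ! j * (cmod (cinner (f j) x))\<^sup>2"
    proof (cases "j < n - 1")
      case False
      then have "eigenvalues M ! (n - 1) \<le> eigenvalues M ! j"
        using j len sorted_eigenvalues[of M] by (auto intro: sorted_nth_mono)
      then show ?thesis by (simp add: mult_right_mono)
    qed (simp add: zero)
  qed
  also have "\<dots> = x \<bullet> (M *v x)" by (rule eigenbasis_form[OF f M, symmetric])
  also have "\<dots> \<le> h * (norm x)\<^sup>2" using h[of c] by (simp add: x_def[symmetric] nx)
  finally show ?thesis using c nx by (simp add: n_def)
qed

context
  fixes M :: "complex^'m^'m" and V :: "complex^('n::{finite,linorder})^'m"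
  assumes M: "hermitian M" and low: "lowest_eigenvectors M V"
begin

lemma lowest_orthonormal: "orthonormal_columns V"
  and lowest_eigenvector:
    "M *v column i V = complex_of_real (eigenvalues M ! col_index i) *s column i V"
  using low by (simp_all add: lowest_eigenvectors_def)

lemma lowest_projector_commute: "M *v (col_projector V *v x) = col_projector V *v (M *v x)"
proof -
  have "M *v (col_projector V *v x) = (\<Sum>i\<in>UNIV. M *v (cinner (column i V) x *s column i V))"
    unfolding col_projector_sum by (rule vec.linear_sum[OF matrix_vector_mul_linear_gen])
  also have "\<dots> = (\<Sum>i\<in>UNIV. cinner (column i V) (M *v x) *s column i V)"
    by (intro sum.cong refl)
      (simp add: matrix_vector_smult lowest_eigenvector hermitian_cinner[OF M, symmetric]
        cinner_smult_left mult.commute)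
  finally show ?thesis by (simp only: col_projector_sum)
qed

text \<open>The gap makes the columns orthogonal to all higher eigenvectors; the trace of the projector
  then leaves no room for the lower eigenvectors outside of its range.\<close>

lemma lowest_projector_eigenbasis:
  assumes f: "eigenbasis M f" and nm: "CARD('n) < CARD('m)" and gap: "eigengap (CARD('n)) M > 0"
    and j: "j < CARD('m)"
  shows "col_projector V *v f j = (if j < CARD('n) then f j else 0)"
proof -
  define n where "n = CARD('n)"
  have n0: "n > 0" by (simp add: n_def)
  have len: "length (eigenvalues M) = CARD('m)"
    using hermitian_eigenbasis[OF M] by blast
  have high: "col_projector V *v f k = 0" if k: "n \<le> k" "k < CARD('m)" for k
  proof -
    have "cinner (column i V) (f k) = 0" for i
    proof (rule hermitian_eigenvectors_orthogonal[OF M lowest_eigenvector eigenbasis_eigenvector[OF f k(2)]])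
      have "col_index i \<le> n - 1"
        using col_index_lt_card[of i] by (simp add: n_def)
      then have "eigenvalues M ! col_index i \<le> eigenvalues M ! (n - 1)"
        using nm len by (intro sorted_nth_mono sorted_eigenvalues) (auto simp: n_def)
      also have "\<dots> < eigenvalues M ! n"
        using gap by (simp add: eigengap_def n_def)
      also have "\<dots> \<le> eigenvalues M ! k"
        using k len by (intro sorted_nth_mono sorted_eigenvalues) auto
      finally show "eigenvalues M ! col_index i \<noteq> eigenvalues M ! k" by simp
    qed
    then show ?thesis by (simp add: col_projector_sum)
  qed
  have "(\<Sum>k<CARD('m). (norm (col_projector V *v f k))\<^sup>2)
      = (\<Sum>k<CARD('m). \<Sum>i\<in>UNIV. (cmod (cinner (f k) (column i V)))\<^sup>2)"
    unfolding norm_col_projector_sq[OF lowest_orthonormal]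
    by (intro sum.cong refl) (metis cnj_cinner complex_mod_cnj)
  also have "\<dots> = (\<Sum>i\<in>UNIV. \<Sum>k<CARD('m). (cmod (cinner (f k) (column i V)))\<^sup>2)"
    by (rule sum.swap)
  also have "\<dots> = real n"
    by (simp add: eigenbasis_norm_sq[OF f, symmetric] norm_column[OF lowest_orthonormal] n_def)
  also have "(\<Sum>k<CARD('m). (norm (col_projector V *v f k))\<^sup>2)
      = (\<Sum>k<n. (norm (col_projector V *v f k))\<^sup>2)"
    by (rule sum.mono_neutral_right) (use nm high in \<open>auto simp: n_def\<close>)
  finally have "(\<Sum>k<n. 1 - (norm (col_projector V *v f k))\<^sup>2) = 0"
    by (simp add: sum_subtractf)
  moreover have "0 \<le> 1 - (norm (col_projector V *v f k))\<^sup>2" if "k < n" for k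
    using norm_col_projector_le[OF lowest_orthonormal, of "f k"] eigenbasis_norm[OF f, of k] that nm
    by (simp add: n_def power_le_one)
  ultimately have "\<forall>k\<in>{..<n}. 1 - (norm (col_projector V *v f k))\<^sup>2 = 0"
    by (subst sum_nonneg_eq_0_iff[symmetric]) auto
  then have "f k - col_projector V *v f k = 0" if "k < n" for k
    using norm_col_projector_pythagoras[OF lowest_orthonormal, of "f k"] eigenbasis_norm[OF f, of k] that nm
    by (simp add: n_def)
  then show ?thesis using high[of j] j by (auto simp: n_def)
qed

lemma lowest_projector_expansion:
  assumes f: "eigenbasis M f" and nm: "CARD('n) < CARD('m)" and gap: "eigengap (CARD('n)) M > 0"
  shows "col_projector V *v x = (\<Sum>j<CARD('n). cinner (f j) x *s f j)"
proof -
  have "col_projector V *v x = col_projector V *v (\<Sum>j<CARD('m). cinner (f j) x *s f j)"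
    using eigenbasis_expansion[OF f, of x] by (rule arg_cong)
  also have "\<dots> = (\<Sum>j<CARD('m). col_projector V *v (cinner (f j) x *s f j))"
    by (rule vec.linear_sum[OF matrix_vector_mul_linear_gen])
  also have "\<dots> = (\<Sum>j<CARD('m). if j < CARD('n) then cinner (f j) x *s f j else 0)"
    by (intro sum.cong refl)
      (simp add: matrix_vector_smult lowest_projector_eigenbasis[OF f nm gap])
  also have "\<dots> = (\<Sum>j<CARD('n). cinner (f j) x *s f j)"
    by (rule sum.mono_neutral_cong_right) (use nm in auto)
  finally show ?thesis .
qed

text \<open>This bound and the next one are read off the expansion in an eigenbasis: vectors in the range have
  no components above the gap, vectors in the complement none below it.\<close>

lemma lowest_form_le:
  assumes nm: "CARD('n) < CARD('m)" and gap: "eigengap (CARD('n)) M > 0"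
    and z: "col_projector V *v z = z"
  shows "z \<bullet> (M *v z) \<le> eigenvalues M ! (CARD('n) - 1) * (norm z)\<^sup>2"
proof -
  obtain f where f: "eigenbasis M f" and len: "length (eigenvalues M) = CARD('m)"
    using hermitian_eigenbasis[OF M] by blast
  have zero: "cinner (f j) z = 0" if "j < CARD('m)" "\<not> j < CARD('n)" for j
    using lowest_projector_eigenbasis[OF f nm gap that(1)] that(2)
      hermitian_cinner[OF hermitian_col_projector, of V "f j" z] z by simp
  have "z \<bullet> (M *v z) = (\<Sum>j<CARD('m). eigenvalues M ! j * (cmod (cinner (f j) z))\<^sup>2)"
    by (rule eigenbasis_form[OF f M])
  also have "\<dots> \<le> (\<Sum>j<CARD('m). eigenvalues M ! (CARD('n) - 1) * (cmod (cinner (f j) z))\<^sup>2)"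
  proof (rule sum_mono)
    fix j assume j: "j \<in> {..<CARD('m)}"
    show "eigenvalues M ! j * (cmod (cinner (f j) z))\<^sup>2
        \<le> eigenvalues M ! (CARD('n) - 1) * (cmod (cinner (f j) z))\<^sup>2"
    proof (cases "j < CARD('n)")
      case True
      then have "eigenvalues M ! j \<le> eigenvalues M ! (CARD('n) - 1)"
        using len nm by (intro sorted_nth_mono sorted_eigenvalues) auto
      then show ?thesis by (simp add: mult_right_mono)
    qed (use j zero in simp)
  qed
  also have "\<dots> = eigenvalues M ! (CARD('n) - 1) * (norm z)\<^sup>2"
    by (simp add: eigenbasis_norm_sq[OF f] sum_distrib_left)
  finally show ?thesis .
qed

lemma complement_form_ge:
  assumes nm: "CARD('n) < CARD('m)" and gap: "eigengap (CARD('n)) M > 0"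
    and y: "col_projector V *v y = 0"
  shows "eigenvalues M ! CARD('n) * (norm y)\<^sup>2 \<le> y \<bullet> (M *v y)"
proof -
  obtain f where f: "eigenbasis M f" and len: "length (eigenvalues M) = CARD('m)"
    using hermitian_eigenbasis[OF M] by blast
  have zero: "cinner (f j) y = 0" if "j < CARD('n)" for j
    using lowest_projector_eigenbasis[OF f nm gap, of j] that nm
      hermitian_cinner[OF hermitian_col_projector, of V "f j" y] y by simp
  have "eigenvalues M ! CARD('n) * (norm y)\<^sup>2
      = (\<Sum>j<CARD('m). eigenvalues M ! CARD('n) * (cmod (cinner (f j) y))\<^sup>2)"
    by (simp add: eigenbasis_norm_sq[OF f] sum_distrib_left)
  also have "\<dots> \<le> (\<Sum>j<CARD('m). eigenvalues M ! j * (cmod (cinner (f j) y))\<^sup>2)"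
  proof (rule sum_mono)
    fix j assume j: "j \<in> {..<CARD('m)}"
    show "eigenvalues M ! CARD('n) * (cmod (cinner (f j) y))\<^sup>2
        \<le> eigenvalues M ! j * (cmod (cinner (f j) y))\<^sup>2"
    proof (cases "j < CARD('n)")
      case False
      then have "eigenvalues M ! CARD('n) \<le> eigenvalues M ! j"
        using len j by (intro sorted_nth_mono sorted_eigenvalues) auto
      then show ?thesis by (simp add: mult_right_mono)
    qed (use zero in simp)
  qed
  also have "\<dots> = y \<bullet> (M *v y)"
    by (rule eigenbasis_form[OF f M, symmetric])
  finally show ?thesis .
qed

end

lemma lowest_projector_unique:
  fixes U V :: "complex^('n::{finite,linorder})^'m"
  assumes "hermitian M" "lowest_eigenvectors M U" "lowest_eigenvectors M V"
    and "CARD('n) < CARD('m)" "eigengap (CARD('n)) M > 0"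
  shows "col_projector U = col_projector V"
proof -
  obtain f where "eigenbasis M f"
    using hermitian_eigenbasis[OF assms(1)] by blast
  then show ?thesis
    by (intro matrix_eqI) (simp add: lowest_projector_expansion[OF assms(1)] assms)
qed

section \<open>Projectors of given rank\<close>

lemma span_columns_eq_range: "vec.span (columns M) = range ((*v) (M :: complex^'n^'m))"
proof
  have "columns M \<subseteq> range ((*v) M)"
    by (auto simp: columns_def column_eq)
  moreover have "vec.subspace (range ((*v) M))"
    by (rule vec.subspace_image[OF vec.subspace_UNIV])
  ultimately show "vec.span (columns M) \<subseteq> range ((*v) M)"
    by (rule vec.span_minimal)
qed (auto intro: matrix_vector_mult_in_columnspace_gen)

lemma rank_eq_dim_range_transpose:
  "rank M = vec.dim (range ((*v) (transpose (M :: complex^'n^'m))))"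
  by (metis columns_transpose row_rank_def_gen span_columns_eq_range vec.dim_span)

definition conj_matrix :: "complex^'n^'m \<Rightarrow> complex^'n^'m" where
  "conj_matrix V = (\<chi> r i. cnj (V $ r $ i))"

lemma conj_conj_matrix [simp]: "conj_matrix (conj_matrix V) = V"
  by (simp add: conj_matrix_def vec_eq_iff)

lemma transpose_eq_conj_adj: "transpose M = conj_matrix (adj M)"
  by (simp add: conj_matrix_def adj_def transpose_def vec_eq_iff)

lemma conj_matrix_mult: "conj_matrix (M ** N) = conj_matrix M ** conj_matrix N"
  by (simp add: conj_matrix_def matrix_matrix_mult_def vec_eq_iff)

lemma adj_conj_matrix: "adj (conj_matrix V) = conj_matrix (adj V)"
  by (simp add: conj_matrix_def adj_def vec_eq_iff)

lemma orthonormal_conj_matrix: "orthonormal_columns V \<Longrightarrow> orthonormal_columns (conj_matrix V)"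
  by (simp add: orthonormal_columns_def adj_conj_matrix conj_matrix_mult[symmetric])
     (simp add: conj_matrix_def mat_def vec_eq_iff)

lemma col_projector_conj_matrix: "col_projector (conj_matrix V) = conj_matrix (col_projector V)"
  by (simp add: col_projector_def adj_conj_matrix conj_matrix_mult)

lemma dim_range_col_projector:
  fixes V :: "complex^'n^'m"
  assumes "orthonormal_columns V"
  shows "vec.dim (range ((*v) (col_projector V))) = CARD('n)"
proof -
  have "range ((*v) (col_projector V)) = range ((*v) V)"
    using col_projector_isometry[OF assms] col_projector_vector[of V]
    by (auto simp: image_iff) metis
  moreover have "inj ((*v) V)"
    by (metis assms adj_isometry injI)
  then have "vec.dim (range ((*v) V)) = vec.dim (UNIV :: (complex^'n) set)"
    by (intro vec.dim_image_eq) (auto intro: inj_on_subset)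
  ultimately show ?thesis by (simp only: vec_dim_card)
qed

lemma col_projector_rank_projectors:
  fixes V :: "complex^'n^'m"
  assumes V: "orthonormal_columns V"
  shows "col_projector V \<in> rank_projectors (CARD('n))"
proof -
  have "transpose (col_projector V) = col_projector (conj_matrix V)"
    using hermitian_col_projector[of V]
    by (simp add: transpose_eq_conj_adj col_projector_conj_matrix hermitian_def)
  then have "rank (col_projector V) = CARD('n)"
    by (simp add: rank_eq_dim_range_transpose dim_range_col_projector orthonormal_conj_matrix V)
  moreover have "col_projector V ** col_projector V = col_projector V"
    by (rule matrix_eqI) (simp add: matrix_vector_mul_assoc[symmetric] col_projector_idem V)
  ultimately show ?thesis
    by (simp add: rank_projectors_def hermitian_col_projector)
qed

text \<open>Conversely, an orthonormal basis of the eigenspace for the eigenvalue 1 represents a given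
  projector.  It is taken for the transpose (the entrywise conjugate), because the rank is defined
  through the rows.\<close>

lemma rank_projectors_col_projector:
  fixes P :: "complex^'m^'m"
  assumes P: "P \<in> rank_projectors (CARD('n::{finite,linorder}))"
  obtains V :: "complex^('n::{finite,linorder})^'m" where "orthonormal_columns V" "col_projector V = P"
proof -
  define Q where "Q = transpose P"
  have PQ: "P = conj_matrix Q" and Qherm: "hermitian Q"
    using P by (auto simp: rank_projectors_def hermitian_def Q_def transpose_eq_conj_adj adj_conj_matrix)
  have "conj_matrix Q ** conj_matrix Q = conj_matrix Q"
    using P by (simp add: rank_projectors_def PQ)
  then have QQ: "Q ** Q = Q"
    by (metis conj_conj_matrix conj_matrix_mult)
  have dimQ: "vec.dim (range ((*v) Q)) = CARD('n)"
    using P by (simp add: rank_projectors_def rank_eq_dim_range_transpose Q_def)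
  obtain F \<mu> where F: "orthonormal_set F" "card F = CARD('m)"
    "\<And>f. f \<in> F \<Longrightarrow> Q *v f = complex_of_real (\<mu> f) *s f"
    "\<And>x. x = (\<Sum>f\<in>F. cinner f x *s f)"
    by (rule hermitian_eigenvector_basis[OF Qherm]) (rule that)
  have fin: "finite F" by (rule orthonormal_set_card(1)[OF F(1)])
  define G where "G = {f\<in>F. \<mu> f = 1}"
  have "range ((*v) Q) = eigenspace Q 1"
    using QQ by (auto simp: eigenspace_def matrix_vector_mul_assoc image_iff) metis
  then have cardG: "card G = CARD('n)"
    using dimQ dim_eigenspace[OF F(1,3,4), of 1] by (simp add: G_def)
  have mu: "\<mu> f = 0 \<or> \<mu> f = 1" if "f \<in> F" for f
  proof -
    have "cinner f f = 1" using F(1) that by (simp add: orthonormal_set_def)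
    have "cinner f (Q *v (Q *v f)) = cinner f (Q *v f)"
      by (simp add: matrix_vector_mul_assoc QQ)
    then have "complex_of_real (\<mu> f * \<mu> f) = complex_of_real (\<mu> f)"
      using F(3)[OF that] \<open>cinner f f = 1\<close> by (simp add: matrix_vector_smult cinner_smult_right)
    then have "\<mu> f * \<mu> f = \<mu> f" by (simp only: of_real_eq_iff)
    then show ?thesis by simp
  qed
  have Qx: "Q *v x = (\<Sum>f\<in>G. cinner f x *s f)" for x
  proof -
    have "Q *v x = Q *v (\<Sum>f\<in>F. cinner f x *s f)"
      using F(4)[of x] by (rule arg_cong)
    also have "\<dots> = (\<Sum>f\<in>F. Q *v (cinner f x *s f))"
      by (rule vec.linear_sum[OF matrix_vector_mul_linear_gen])
    also have "\<dots> = (\<Sum>f\<in>G. cinner f x *s f)"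
      by (rule sum.mono_neutral_cong_right)
        (use mu in \<open>auto simp: fin G_def matrix_vector_smult F(3)\<close>)
    finally show ?thesis .
  qed
  have "finite G" using fin by (simp add: G_def)
  with cardG obtain g where g: "bij_betw g (UNIV :: 'n set) G"
    using finite_same_card_bij[of "UNIV :: 'n set" G] by auto
  define V :: "complex^('n::{finite,linorder})^'m" where "V = (\<chi> r i. g i $ r)"
  have col: "column i V = g i" for i
    by (simp add: V_def column_def)
  have "orthonormal_columns V"
    unfolding orthonormal_columns_iff col
  proof (intro allI)
    fix i j
    have "g i \<in> F" "g j \<in> F" "g i = g j \<longleftrightarrow> i = j"
      using g by (auto simp: bij_betw_def G_def inj_eq)
    then show "cinner (g i) (g j) = (if i = j then 1 else 0)"
      using F(1) by (simp add: orthonormal_set_def)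
  qed
  moreover have "col_projector V = Q"
  proof (rule matrix_eqI)
    fix x
    show "col_projector V *v x = Q *v x"
      unfolding col_projector_sum col Qx by (rule sum.reindex_bij_betw[OF g])
  qed
  ultimately show ?thesis
    using that[of "conj_matrix V"] by (simp add: orthonormal_conj_matrix col_projector_conj_matrix PQ)
qed

section \<open>The adaptive compression\<close>

text \<open>This is the Schur complement of \<open>- B\<close> with respect to the range of \<open>W\<close>, extended by zero to
  that range.  The iteration diagonalizes \<open>(A + B) + defect B W\<close>, and all estimates below are
  made in the seminorm of a defect.\<close>

definition defect :: "complex^'m^'m \<Rightarrow> complex^'n^'m \<Rightarrow> complex^'m^'m" where
  "defect B W = compression B W - B"

lemma neg_definite_pos:
  assumes "neg_definite B"
  shows "0 \<le> - (x \<bullet> (B *v x))"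
  using assms unfolding neg_definite_def by (cases "x = 0") (auto simp: less_imp_le)

lemma neg_definite_coercive:
  fixes B :: "complex^'m^'m"
  assumes B: "neg_definite B"
  obtains m where "m > 0" "\<And>x. m * (norm x)\<^sup>2 \<le> - (x \<bullet> (B *v x))"
proof -
  have "axis undefined 1 \<in> sphere (0 :: complex^'m) 1"
    by (simp add: norm_axis_1)
  then have "sphere (0 :: complex^'m) 1 \<noteq> {}" by blast
  moreover have "continuous_on (sphere 0 1) (\<lambda>x. - (x \<bullet> (B *v x)))"
    by (intro continuous_intros linear_continuous_on matrix_vector_mul_bounded_linear)
  ultimately obtain x where "x \<in> sphere 0 1"
    and "\<forall>y\<in>sphere 0 1. - (x \<bullet> (B *v x)) \<le> - (y \<bullet> (B *v y))"
    using continuous_attains_inf[OF compact_sphere, of 0 1 "\<lambda>x. - (x \<bullet> (B *v x))"] by blast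
  then have x: "norm x = 1"
    and min: "\<And>y. norm y = 1 \<Longrightarrow> - (x \<bullet> (B *v x)) \<le> - (y \<bullet> (B *v y))"
    by auto
  define m where "m = - (x \<bullet> (B *v x))"
  have "m > 0"
    using B x unfolding m_def neg_definite_def by (metis neg_0_less_iff_less norm_zero zero_neq_one)
  moreover have "m * (norm y)\<^sup>2 \<le> - (y \<bullet> (B *v y))" for y
  proof (cases "y = 0")
    case False
    have "m \<le> - ((inverse (norm y) *\<^sub>R y) \<bullet> (B *v (inverse (norm y) *\<^sub>R y)))"
      unfolding m_def by (rule min) (simp add: False)
    also have "\<dots> = - (y \<bullet> (B *v y)) / (norm y)\<^sup>2"
      by (simp only: matrix_vector_scaleR inner_scaleR_left inner_scaleR_right)
        (simp add: divide_inverse power2_eq_square)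
    finally show ?thesis using False by (simp add: field_simps)
  qed simp
  ultimately show ?thesis using that by blast
qed

lemma neg_form_le: "- (x \<bullet> (B *v x)) \<le> spectral_norm B * (norm (x :: complex^'m))\<^sup>2"
proof -
  have "- (x \<bullet> (B *v x)) \<le> norm x * norm (B *v x)"
    using Cauchy_Schwarz_ineq2[of x "B *v x"] by linarith
  also have "\<dots> \<le> norm x * (spectral_norm B * norm x)"
    by (intro mult_left_mono norm_matrix_vector_le) simp
  finally show ?thesis by (simp add: power2_eq_square mult_ac)
qed

lemma compressed_invertible:
  fixes W :: "complex^'n^'m"
  assumes B: "neg_definite B" and W: "orthonormal_columns W"
  shows "invertible (adj W ** B ** W)"
  unfolding invertible_left_inverse matrix_left_invertible_ker
proof (intro allI impI)
  fix c assume "adj W ** B ** W *v c = 0"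
  then have "c \<bullet> (adj W *v (B *v (W *v c))) = 0"
    by (simp add: matrix_vector_mul_assoc matrix_mul_assoc)
  then have "(W *v c) \<bullet> (B *v (W *v c)) = 0"
    by (simp add: inner_adj)
  then have "W *v c = 0"
    using B unfolding neg_definite_def by (metis less_irrefl)
  then show "c = 0"
    by (metis W norm_eq_zero norm_isometry)
qed

lemma matrix_inv_works:
  fixes G :: "complex^'n^'n"
  assumes "invertible G"
  shows "matrix_inv G ** G = mat 1" "G ** matrix_inv G = mat 1"
  using someI_ex[OF assms[unfolded invertible_def]] unfolding matrix_inv_def by blast+

lemma compression_vector:
  "compression B W *v y = B *v (W *v (matrix_inv (adj W ** B ** W) *v (adj W *v (B *v y))))"
  by (simp add: compression_def matrix_vector_mul_assoc matrix_mul_assoc)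

text \<open>The vector \<open>W t\<close> is the projection of \<open>y\<close> onto the range of \<open>W\<close> that is orthogonal for the
  inner product of \<open>- B\<close>; the defect applies \<open>- B\<close> to the remainder.\<close>

lemma defect_vector:
  fixes W :: "complex^'n^'m"
  assumes B: "neg_definite B" and W: "orthonormal_columns W"
  obtains t where "defect B W *v y = - (B *v (y - W *v t))" "adj W *v (B *v (y - W *v t)) = 0"
proof -
  define t where "t = matrix_inv (adj W ** B ** W) *v (adj W *v (B *v y))"
  have "adj W *v (B *v (W *v t)) = (adj W ** B ** W ** matrix_inv (adj W ** B ** W)) *v (adj W *v (B *v y))"
    by (simp add: t_def matrix_vector_mul_assoc matrix_mul_assoc)
  also have "\<dots> = adj W *v (B *v y)"
    by (simp add: matrix_inv_works compressed_invertible[OF B W])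
  finally have "adj W *v (B *v (y - W *v t)) = 0"
    by (simp add: matrix_vector_mult_diff_distrib)
  moreover have "defect B W *v y = - (B *v (y - W *v t))"
    by (simp add: defect_def matrix_vector_mult_diff_rdistrib compression_vector t_def
        matrix_vector_mult_diff_distrib)
  ultimately show ?thesis using that by blast
qed

section \<open>Energy seminorms\<close>

definition psd :: "complex^'m^'m \<Rightarrow> bool" where
  "psd T \<longleftrightarrow> hermitian T \<and> (\<forall>x. 0 \<le> x \<bullet> (T *v x))"

definition energy :: "complex^'m^'m \<Rightarrow> complex^'m \<Rightarrow> real" where
  "energy T x = sqrt (x \<bullet> (T *v x))"

lemma minus_matrix_vector: "(- T) *v x = - (T *v (x :: complex^'n))"
  by (simp add: vec_eq_iff matrix_vector_mult_def sum_negf)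

lemma psd_neg_definite: "neg_definite B \<Longrightarrow> psd (- B)"
  using neg_definite_pos[of B]
  by (auto simp: psd_def neg_definite_def hermitian_def minus_matrix_vector adj_def vec_eq_iff)

lemma energy_sq: "psd T \<Longrightarrow> (energy T x)\<^sup>2 = x \<bullet> (T *v x)"
  by (simp add: energy_def psd_def)

lemma energy_nonneg: "psd T \<Longrightarrow> 0 \<le> energy T x"
  by (simp add: energy_def psd_def)

lemma energy_Cauchy_Schwarz:
  assumes "psd T"
  shows "\<bar>x \<bullet> (T *v y)\<bar> \<le> energy T x * energy T y"
proof -
  have "(x \<bullet> (T *v y))\<^sup>2 \<le> (x \<bullet> (T *v x)) * (y \<bullet> (T *v y))"
    using assms by (intro psd_Cauchy_Schwarz[where S=UNIV]) (auto simp: psd_def hermitian_inner)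
  also have "\<dots> = (energy T x * energy T y)\<^sup>2"
    by (simp add: power_mult_distrib energy_sq assms)
  finally show ?thesis
    using assms by (intro power2_le_imp_le[where x="\<bar>_\<bar>"]) (auto intro: mult_nonneg_nonneg energy_nonneg)
qed

lemma energy_triangle:
  assumes "psd T"
  shows "energy T (x + y) \<le> energy T x + energy T y"
proof (rule power2_le_imp_le)
  have "y \<bullet> (T *v x) = x \<bullet> (T *v y)"
    using assms by (metis hermitian_inner inner_commute psd_def)
  then have "(energy T (x + y))\<^sup>2 = (energy T x)\<^sup>2 + 2 * (x \<bullet> (T *v y)) + (energy T y)\<^sup>2"
    by (simp add: energy_sq assms inner_add_left inner_add_right matrix_vector_right_distrib)
  also have "\<dots> \<le> (energy T x + energy T y)\<^sup>2"
    using energy_Cauchy_Schwarz[OF assms, of x y] by (simp add: power2_sum)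
  finally show "(energy T (x + y))\<^sup>2 \<le> (energy T x + energy T y)\<^sup>2" .
qed (intro add_nonneg_nonneg energy_nonneg assms)

lemma energy_neg_le: "energy (- B) x \<le> sqrt (spectral_norm B) * norm (x :: complex^'m)"
proof -
  have "energy (- B) x \<le> sqrt (spectral_norm B * (norm x)\<^sup>2)"
    unfolding energy_def using neg_form_le[of x B] by (simp add: minus_matrix_vector)
  then show ?thesis by (simp add: real_sqrt_mult)
qed

context
  fixes B :: "complex^'m^'m" and W :: "complex^'n^'m"
  assumes B: "neg_definite B" and W: "orthonormal_columns W"
begin

lemma defect_decomposition:
  obtains t where
    "defect B W *v y = - (B *v (y - W *v t))"
    "\<And>s. (W *v s) \<bullet> (defect B W *v y) = 0"
proof -
  obtain t where t: "defect B W *v y = - (B *v (y - W *v t))" "adj W *v (B *v (y - W *v t)) = 0"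
    using defect_vector[OF B W, where y=y] by blast
  then have "(W *v s) \<bullet> (defect B W *v y) = 0" for s
    by (simp add: inner_adj)
  with t(1) that show ?thesis by blast
qed

lemma hermitian_defect: "hermitian (defect B W)"
proof (rule hermitianI)
  fix x y
  obtain s where s: "defect B W *v x = - (B *v (x - W *v s))"
    "\<And>r. (W *v r) \<bullet> (defect B W *v x) = 0" by (rule defect_decomposition) (rule that)
  obtain t where t: "defect B W *v y = - (B *v (y - W *v t))"
    "\<And>r. (W *v r) \<bullet> (defect B W *v y) = 0" by (rule defect_decomposition) (rule that)
  have "x \<bullet> (defect B W *v y) = (x - W *v s) \<bullet> (defect B W *v y)"
    by (simp add: inner_diff_left t(2))
  also have "\<dots> = - ((x - W *v s) \<bullet> (B *v (y - W *v t)))"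
    by (simp only: t(1) inner_minus_right)
  also have "\<dots> = - (B *v (x - W *v s)) \<bullet> (y - W *v t)"
    using B by (simp add: neg_definite_def hermitian_inner)
  also have "\<dots> = (y - W *v t) \<bullet> (defect B W *v x)"
    by (simp only: s(1) inner_commute)
  also have "\<dots> = (defect B W *v x) \<bullet> y"
    by (simp add: inner_diff_left s(2)) (simp add: inner_commute)
  finally show "x \<bullet> (defect B W *v y) = (defect B W *v x) \<bullet> y" .
qed

lemma defect_isometry_eq_0: "defect B W *v (W *v c) = 0"
proof -
  have "z \<bullet> (defect B W *v (W *v c)) = 0" for z
    using hermitian_inner[OF hermitian_defect, of z "W *v c"]
    by (metis defect_decomposition inner_commute)
  then show ?thesis by (metis inner_eq_zero_iff)
qed

lemma defect_add_isometry: "defect B W *v (y - W *v c) = defect B W *v y"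
  by (simp add: matrix_vector_mult_diff_distrib defect_isometry_eq_0)

text \<open>The form of the defect at \<open>y\<close> is the squared distance of \<open>y\<close> from the range of \<open>W\<close> in the norm
  \<open>energy (- B)\<close>: a minimum over the range of \<open>W\<close>, attained here and bounded by any competitor in
  \<open>energy_defect_le\<close>.  Defects at two ranges are compared by exchanging competitors.\<close>

lemma defect_form_attained:
  "\<exists>t. y \<bullet> (defect B W *v y) = (y - W *v t) \<bullet> (- B *v (y - W *v t))"
proof -
  obtain t where t: "defect B W *v y = - (B *v (y - W *v t))"
    "\<And>r. (W *v r) \<bullet> (defect B W *v y) = 0" by (rule defect_decomposition) (rule that)
  have "y \<bullet> (defect B W *v y) = (y - W *v t) \<bullet> (defect B W *v y)"
    by (simp add: inner_diff_left t(2))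
  then show ?thesis by (auto simp: t(1) minus_matrix_vector)
qed

lemma psd_defect: "psd (defect B W)"
proof -
  have "0 \<le> y \<bullet> (defect B W *v y)" for y
    using defect_form_attained[of y] psd_neg_definite[OF B] unfolding psd_def by metis
  then show ?thesis by (simp add: psd_def hermitian_defect)
qed

lemma energy_defect_attained: "\<exists>t. energy (defect B W) y = energy (- B) (y - W *v t)"
  using defect_form_attained[of y] unfolding energy_def by metis

lemma energy_defect_le_neg: "energy (defect B W) y \<le> energy (- B) y"
proof -
  obtain t where t: "defect B W *v y = - (B *v (y - W *v t))"
    "\<And>r. (W *v r) \<bullet> (defect B W *v y) = 0" by (rule defect_decomposition) (rule that)
  define z where "z = y - W *v t"
  have "(W *v t) \<bullet> (B *v z) = 0"
    using t(2)[of t] by (simp add: t(1) z_def)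
  moreover have "z \<bullet> (B *v (W *v t)) = (W *v t) \<bullet> (B *v z)"
    using B by (metis hermitian_inner inner_commute neg_definite_def)
  moreover have "y = z + W *v t" by (simp add: z_def)
  moreover have "y \<bullet> (defect B W *v y) = - (y \<bullet> (B *v z))"
    by (simp add: t(1) z_def)
  ultimately have "y \<bullet> (defect B W *v y) + (- ((W *v t) \<bullet> (B *v (W *v t)))) = y \<bullet> (- B *v y)"
    by (simp add: minus_matrix_vector inner_add_left inner_add_right inner_diff_right
        matrix_vector_right_distrib)
  then have "y \<bullet> (defect B W *v y) \<le> y \<bullet> (- B *v y)"
    using neg_definite_pos[OF B, of "W *v t"] by linarith
  then show ?thesis by (simp add: energy_def)
qed

lemma energy_defect_shift: "energy (defect B W) (y - W *v s) = energy (defect B W) y"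
  unfolding energy_def
  by (simp add: defect_add_isometry inner_diff_left) (metis defect_decomposition)

lemma energy_defect_le: "energy (defect B W) y \<le> energy (- B) (y - W *v s)"
  using energy_defect_shift energy_defect_le_neg by metis

lemma energy_defect_col_projector:
  "energy (defect B W) (y - col_projector W *v y) = energy (defect B W) y"
  by (simp add: col_projector_vector energy_defect_shift)

end

section \<open>Distance of two ranges\<close>

text \<open>Both sides are \<open>n\<close> minus the trace of the product of the two projectors.  So for ranges of equal
  dimension, closeness of one to the other is symmetric.\<close>

lemma sum_projector_complement_sym:
  fixes V W :: "complex^'n^'m"
  assumes V: "orthonormal_columns V" and W: "orthonormal_columns W"
  shows "(\<Sum>i\<in>UNIV. (norm (column i W - col_projector V *v column i W))\<^sup>2)
       = (\<Sum>i\<in>UNIV. (norm (column i V - col_projector W *v column i V))\<^sup>2)"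
proof -
  have expand: "(\<Sum>i\<in>UNIV. (norm (column i U' - col_projector U *v column i U'))\<^sup>2)
      = real CARD('n) - (\<Sum>i\<in>UNIV. \<Sum>j\<in>UNIV. (cmod (cinner (column j U) (column i U')))\<^sup>2)"
    if U: "orthonormal_columns U" and U': "orthonormal_columns U'" for U U' :: "complex^'n^'m"
  proof -
    have "(norm (column i U' - col_projector U *v column i U'))\<^sup>2
        = 1 - (\<Sum>j\<in>UNIV. (cmod (cinner (column j U) (column i U')))\<^sup>2)" for i
      using norm_col_projector_pythagoras[OF U, of "column i U'"]
      by (simp add: norm_col_projector_sq[OF U] norm_column[OF U'])
    then show ?thesis by (simp add: sum_subtractf)
  qed
  have "(\<Sum>i\<in>UNIV. \<Sum>j\<in>UNIV. (cmod (cinner (column j V) (column i W)))\<^sup>2)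
      = (\<Sum>j\<in>UNIV. \<Sum>i\<in>UNIV. (cmod (cinner (column i W) (column j V)))\<^sup>2)"
    by (subst sum.swap, intro sum.cong refl) (metis cnj_cinner complex_mod_cnj)
  then show ?thesis by (simp add: expand V W)
qed

lemma norm_complement_isometry_le:
  fixes V W :: "complex^'n^'m"
  assumes q: "\<And>i. norm (column i W - col_projector V *v column i W) \<le> q"
  shows "norm (W *v c - col_projector V *v (W *v c)) \<le> real CARD('n) * q * norm c"
proof -
  have "W *v c - col_projector V *v (W *v c)
      = (\<Sum>i\<in>UNIV. (c $ i) *s (column i W - col_projector V *v column i W))"
    unfolding matrix_vector_eq_column_sum[of W] vec.linear_sum[OF matrix_vector_mul_linear_gen]
    by (simp add: matrix_vector_smult sum_subtractf vector_ssub_ldistrib)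
  also have "norm \<dots> \<le> (\<Sum>i\<in>(UNIV :: 'n set). norm c * q)"
    by (rule order.trans[OF norm_sum sum_mono]) (simp only: norm_smult, intro mult_mono Finite_Cartesian_Product.norm_nth_le q, auto)
  finally show ?thesis by (simp add: mult_ac)
qed

text \<open>With \<open>P\<close> and \<open>R\<close> the projectors of \<open>V\<close> and \<open>W\<close>, the difference is
  \<open>P - R = P (1 - R) - (1 - P) R\<close>, and \<open>P (1 - R)\<close> is the adjoint of \<open>(1 - R) P\<close>.\<close>

lemma norm_projector_diff_le:
  fixes V W :: "complex^'n^'m"
  assumes V: "orthonormal_columns V" and W: "orthonormal_columns W"
    and VW: "\<And>c. norm (W *v c - col_projector V *v (W *v c)) \<le> d * norm c"
    and WV: "\<And>c. norm (V *v c - col_projector W *v (V *v c)) \<le> d * norm c" and d: "0 \<le> d"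
  shows "norm ((col_projector V - col_projector W) *v x) \<le> 2 * d * norm x"
proof -
  have adj_le: "norm (adj U *v x) \<le> norm x" if "orthonormal_columns U" for U :: "complex^'n^'m" and x
    using norm_col_projector_le[OF that, of x] by (simp add: col_projector_vector norm_isometry that)
  define x' where "x' = col_projector W *v x"
  have 1: "norm (x' - col_projector V *v x') \<le> d * norm x"
  proof -
    have "norm (x' - col_projector V *v x') \<le> d * norm (adj W *v x)"
      unfolding x'_def col_projector_vector[of W] by (rule VW)
    also have "\<dots> \<le> d * norm x"
      using d by (intro mult_left_mono adj_le W)
    finally show ?thesis .
  qed
  define z where "z = col_projector V *v (x - x')"
  have 2: "norm z \<le> d * norm x"
  proof (cases "z = 0")
    case False
    have Vz: "col_projector V *v z = z" by (simp add: z_def col_projector_idem V)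
    have "(norm z)\<^sup>2 = z \<bullet> (col_projector V *v (x - x'))"
      by (simp add: power2_norm_eq_inner z_def)
    also have "\<dots> = z \<bullet> (x - col_projector W *v x)"
      by (simp add: hermitian_inner[OF hermitian_col_projector, symmetric] Vz x'_def)
    also have "\<dots> = (z - col_projector W *v z) \<bullet> x"
      by (simp add: inner_diff_left inner_diff_right hermitian_inner[OF hermitian_col_projector])
    also have "\<dots> \<le> norm (z - col_projector W *v z) * norm x"
      by (rule norm_cauchy_schwarz)
    also have "\<dots> \<le> d * norm z * norm x"
    proof (rule mult_right_mono)
      have "z = V *v (adj V *v z)" using Vz by (simp add: col_projector_vector)
      then have "norm (z - col_projector W *v z) \<le> d * norm (adj V *v z)"
        using WV[of "adj V *v z"] by simp
      also have "\<dots> \<le> d * norm z" using d by (intro mult_left_mono adj_le V)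
      finally show "norm (z - col_projector W *v z) \<le> d * norm z" .
    qed simp
    finally show ?thesis using False by (simp add: power2_eq_square mult_ac)
  qed (simp add: d)
  have "(col_projector V - col_projector W) *v x = z - (x' - col_projector V *v x')"
    by (simp add: matrix_vector_mult_diff_rdistrib matrix_vector_mult_diff_distrib z_def x'_def)
  also have "norm \<dots> \<le> norm z + norm (x' - col_projector V *v x')"
    by (rule norm_triangle_ineq4)
  finally show ?thesis using 1 2 by simp
qed

section \<open>Lifting to a neighbouring range\<close>

text \<open>If the range of \<open>W\<close> is close to that of \<open>V\<close>, every vector of the latter is the projection of
  exactly one vector of the former, which is only slightly longer.\<close>

lemma lift_exists:
  fixes V W :: "complex^'n^'m"
  assumes V: "orthonormal_columns V" and W: "orthonormal_columns W"
    and VW: "\<And>c. norm (W *v c - col_projector V *v (W *v c)) \<le> d * norm c" and d: "0 \<le> d" "d < 1"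
  obtains K :: "complex^'m^'m" where
    "\<And>x. \<exists>c. K *v x = W *v c" "\<And>x. col_projector V *v (K *v x) = col_projector V *v x"
    "\<And>x. norm (K *v x) \<le> norm x / sqrt (1 - d\<^sup>2)"
proof -
  have d2: "d\<^sup>2 < 1" using d by (simp add: power_less_one_iff)
  \<comment> \<open>The restriction of the projector to the range of \<open>W\<close>, in the coordinates given by the columns.\<close>
  define G where "G = adj V ** W"
  have G: "(1 - d\<^sup>2) * (norm c)\<^sup>2 \<le> (norm (G *v c))\<^sup>2" for c
  proof -
    have "norm (G *v c) = norm (col_projector V *v (W *v c))"
      by (simp add: G_def col_projector_vector norm_isometry V matrix_vector_mul_assoc[symmetric])
    moreover have "(norm (W *v c - col_projector V *v (W *v c)))\<^sup>2 \<le> (d * norm c)\<^sup>2"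
      by (intro power_mono VW) simp
    ultimately show ?thesis
      using norm_col_projector_pythagoras[OF V, of "W *v c"]
      by (simp add: norm_isometry[OF W] power_mult_distrib algebra_simps)
  qed
  have "invertible G"
    unfolding invertible_left_inverse matrix_left_invertible_ker
  proof (intro allI impI)
    fix c assume "G *v c = 0"
    then have "(1 - d\<^sup>2) * (norm c)\<^sup>2 \<le> 0" using G[of c] by simp
    then show "c = 0" using d2 by (simp add: mult_le_0_iff)
  qed
  then have GG: "G *v (matrix_inv G *v c) = c" for c
    by (simp add: matrix_vector_mul_assoc matrix_inv_works)
  define K where "K = W ** matrix_inv G ** adj V"
  have K: "K *v x = W *v (matrix_inv G *v (adj V *v x))" for x
    by (simp add: K_def matrix_vector_mul_assoc matrix_mul_assoc)
  have "col_projector V *v (K *v x) = V *v (G *v (matrix_inv G *v (adj V *v x)))" for x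
    by (simp add: K col_projector_def G_def matrix_vector_mul_assoc matrix_mul_assoc)
  then have 1: "col_projector V *v (K *v x) = col_projector V *v x" for x
    by (simp add: GG col_projector_vector)
  have 2: "norm (K *v x) \<le> norm x / sqrt (1 - d\<^sup>2)" for x
  proof -
    define c where "c = matrix_inv G *v (adj V *v x)"
    have "(1 - d\<^sup>2) * (norm c)\<^sup>2 \<le> (norm (adj V *v x))\<^sup>2"
      using G[of c] by (simp add: c_def GG)
    also have "\<dots> = (norm (col_projector V *v x))\<^sup>2"
      by (simp add: col_projector_vector norm_isometry V)
    also have "\<dots> \<le> (norm x)\<^sup>2"
      by (intro power_mono norm_col_projector_le V) simp
    finally have "sqrt ((1 - d\<^sup>2) * (norm c)\<^sup>2) \<le> sqrt ((norm x)\<^sup>2)"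
      by (rule real_sqrt_le_mono)
    then have "sqrt (1 - d\<^sup>2) * norm c \<le> norm x" by (simp add: real_sqrt_mult)
    moreover have "norm (K *v x) = norm c" by (simp add: K c_def norm_isometry W)
    ultimately show ?thesis using d2 by (simp add: field_simps)
  qed
  show ?thesis
    by (rule that[of K]) (use K 1 2 in auto)
qed

text \<open>Sums of energies over orthonormal columns are traces.  In an eigenbasis of \<open>T\<close> both sides are
  nonnegative combinations of terms that Bessel's inequality compares.\<close>

lemma sum_energy_lift_le:
  fixes U W :: "complex^'n^'m" and K T :: "complex^'m^'m"
  assumes T: "psd T" and U: "orthonormal_columns U" and W: "orthonormal_columns W"
    and KW: "\<And>x. \<exists>c. K *v x = W *v c" and K: "\<And>x. norm (K *v x) \<le> k * norm x"
  shows "(\<Sum>i\<in>UNIV. (energy T (K *v column i U))\<^sup>2) \<le> k\<^sup>2 * (\<Sum>i\<in>UNIV. (energy T (column i W))\<^sup>2)"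
proof -
  have hT: "hermitian T" using T by (simp add: psd_def)
  obtain f where f: "eigenbasis T f"
    using hermitian_eigenbasis[OF hT] by blast
  define \<mu> where "\<mu> j = eigenvalues T ! j" for j
  have \<mu>: "0 \<le> \<mu> j" if "j < CARD('m)" for j
  proof -
    have "f j \<bullet> (T *v f j) = \<mu> j"
      using eigenbasis_eigenvector[OF f that] eigenbasis_norm[OF f that]
      by (simp add: of_real_smult \<mu>_def power2_norm_eq_inner[symmetric])
    then show ?thesis using T by (metis psd_def)
  qed
  have expand: "(\<Sum>i\<in>UNIV. (energy T (g i))\<^sup>2)
      = (\<Sum>j<CARD('m). \<mu> j * (\<Sum>i\<in>UNIV. (cmod (cinner (f j) (g i)))\<^sup>2))" for g :: "'n \<Rightarrow> complex^'m"
    unfolding energy_sq[OF T] eigenbasis_form[OF f hT] \<mu>_def sum_distrib_left by (rule sum.swap)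
  have RK: "col_projector W *v (K *v x) = K *v x" for x
    using KW[of x] by (auto simp: col_projector_isometry W)
  have adjK: "adj K *v (col_projector W *v g) = adj K *v g" for g
    by (rule cinner_eqI)
      (metis RK cinner_adj hermitian_cinner hermitian_col_projector)
  have adjK_le: "norm (adj K *v g) \<le> k * norm g" for g
  proof (cases "adj K *v g = 0")
    case True
    have "0 \<le> k * norm g" using K[of g] norm_ge_zero[of "K *v g"] by linarith
    with True show ?thesis by simp
  next
    case False
    have "(norm (adj K *v g))\<^sup>2 = (K *v (adj K *v g)) \<bullet> g"
      by (simp add: power2_norm_eq_inner inner_adj)
    also have "\<dots> \<le> norm (K *v (adj K *v g)) * norm g"
      by (rule norm_cauchy_schwarz)
    also have "\<dots> \<le> k * norm (adj K *v g) * norm g"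
      by (intro mult_right_mono K) simp
    finally show ?thesis using False by (simp add: power2_eq_square mult_ac)
  qed
  have bessel: "(\<Sum>i\<in>UNIV. (cmod (cinner g (K *v column i U)))\<^sup>2)
      \<le> k\<^sup>2 * (\<Sum>i\<in>UNIV. (cmod (cinner g (column i W)))\<^sup>2)" for g
  proof -
    have "(\<Sum>i\<in>UNIV. (cmod (cinner g (K *v column i U)))\<^sup>2)
        = (\<Sum>i\<in>UNIV. (cmod (cinner (column i U) (adj K *v g)))\<^sup>2)"
      by (intro sum.cong refl) (metis cinner_adj cnj_cinner complex_mod_cnj)
    also have "\<dots> \<le> (norm (adj K *v g))\<^sup>2"
      using norm_col_projector_sq[OF U, of "adj K *v g"]
        norm_col_projector_le[OF U, of "adj K *v g"] power_mono[OF _ norm_ge_zero] by metis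
    also have "\<dots> \<le> (k * norm (col_projector W *v g))\<^sup>2"
      using adjK_le[of "col_projector W *v g"] by (simp add: adjK power_mono)
    also have "\<dots> = k\<^sup>2 * (\<Sum>i\<in>UNIV. (cmod (cinner (column i W) g))\<^sup>2)"
      by (simp add: power_mult_distrib norm_col_projector_sq[OF W])
    also have "(\<Sum>i\<in>UNIV. (cmod (cinner (column i W) g))\<^sup>2) = (\<Sum>i\<in>UNIV. (cmod (cinner g (column i W)))\<^sup>2)"
      by (intro sum.cong refl) (metis cnj_cinner complex_mod_cnj)
    finally show ?thesis .
  qed
  have "(\<Sum>i\<in>UNIV. (energy T (K *v column i U))\<^sup>2)
      \<le> (\<Sum>j<CARD('m). \<mu> j * (k\<^sup>2 * (\<Sum>i\<in>UNIV. (cmod (cinner (f j) (column i W)))\<^sup>2)))"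
    unfolding expand by (intro sum_mono mult_left_mono bessel \<mu>) simp
  also have "\<dots> = k\<^sup>2 * (\<Sum>i\<in>UNIV. (energy T (column i W))\<^sup>2)"
    unfolding expand by (simp add: sum_distrib_left mult_ac)
  finally show ?thesis .
qed

section \<open>Comparing the energies of two defects\<close>

context
  fixes B :: "complex^'m^'m" and m :: real
  assumes B: "neg_definite B" and m: "m > 0" "\<And>x. m * (norm x)\<^sup>2 \<le> - (x \<bullet> (B *v x))"
begin

lemma energy_neg_ge: "sqrt m * norm x \<le> energy (- B) x"
proof -
  have "sqrt (m * (norm x)\<^sup>2) \<le> energy (- B) x"
    unfolding energy_def using m(2)[of x] by (simp add: minus_matrix_vector)
  then show ?thesis by (simp add: real_sqrt_mult)
qed

text \<open>A vector orthogonal to the range of \<open>V\<close> is at least its own length away from that range.\<close>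

lemma energy_defect_ge:
  fixes V :: "complex^'n^'m"
  assumes V: "orthonormal_columns V" and y: "col_projector V *v y = 0"
  shows "sqrt m * norm y \<le> energy (defect B V) y"
proof -
  obtain t where t: "energy (defect B V) y = energy (- B) (y - V *v t)"
    using energy_defect_attained[OF B V] by blast
  have "(norm y)\<^sup>2 \<le> (norm (y - V *v t))\<^sup>2"
    using norm_col_projector_pythagoras[OF V, of "y - V *v t"]
    by (simp add: matrix_vector_mult_diff_distrib y col_projector_isometry V)
  then have "norm y \<le> norm (y - V *v t)"
    by (rule power2_le_imp_le) simp
  then have "sqrt m * norm y \<le> sqrt m * norm (y - V *v t)"
    using m(1) by (intro mult_left_mono) auto
  also have "\<dots> \<le> energy (defect B V) y"
    unfolding t by (rule energy_neg_ge)
  finally show ?thesis .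
qed

text \<open>Moving the point of the range of \<open>U\<close> nearest to \<open>y\<close> into the range of \<open>W\<close> gives a competitor for
  the distance of \<open>y\<close> from the range of \<open>W\<close>.  This makes the defect Lipschitz in the range.\<close>

lemma energy_defect_compare:
  fixes U W :: "complex^'n^'m"
  assumes U: "orthonormal_columns U" and W: "orthonormal_columns W"
    and UW: "\<And>c. norm (U *v c - col_projector W *v (U *v c)) \<le> d * norm c" and d: "0 \<le> d"
  shows "energy (defect B W) y
    \<le> energy (defect B U) y + sqrt (spectral_norm B) * d * (1 + sqrt (spectral_norm B) / sqrt m) * norm y"
proof -
  have nB: "psd (- B)" by (rule psd_neg_definite[OF B])
  obtain t where t: "energy (defect B U) y = energy (- B) (y - U *v t)"
    using energy_defect_attained[OF B U] by blast
  have "sqrt m * norm (y - U *v t) \<le> energy (- B) (y - U *v t)" by (rule energy_neg_ge)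
  also have "\<dots> \<le> energy (- B) y"
    unfolding t[symmetric] by (rule energy_defect_le_neg[OF B U])
  also have "\<dots> \<le> sqrt (spectral_norm B) * norm y" by (rule energy_neg_le)
  finally have 1: "norm (y - U *v t) \<le> sqrt (spectral_norm B) / sqrt m * norm y"
    using m(1) by (simp add: field_simps)
  have "norm t = norm (U *v t)" by (simp add: norm_isometry U)
  also have "\<dots> \<le> norm y + norm (y - U *v t)"
    using norm_triangle_ineq4[of y "y - U *v t"] by simp
  also have "\<dots> \<le> (1 + sqrt (spectral_norm B) / sqrt m) * norm y"
    using 1 by (simp add: distrib_right)
  finally have 2: "norm t \<le> (1 + sqrt (spectral_norm B) / sqrt m) * norm y" .
  define r where "r = U *v t - col_projector W *v (U *v t)"
  have "energy (defect B W) y \<le> energy (- B) (y - W *v (adj W *v (U *v t)))"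
    by (rule energy_defect_le[OF B W])
  also have "y - W *v (adj W *v (U *v t)) = (y - U *v t) + r"
    by (simp add: r_def col_projector_vector)
  also have "energy (- B) \<dots> \<le> energy (- B) (y - U *v t) + energy (- B) r"
    by (rule energy_triangle[OF nB])
  also have "energy (- B) r \<le> sqrt (spectral_norm B) * (d * ((1 + sqrt (spectral_norm B) / sqrt m) * norm y))"
  proof -
    have "energy (- B) r \<le> sqrt (spectral_norm B) * norm r" by (rule energy_neg_le)
    also have "norm r \<le> d * norm t" unfolding r_def by (rule UW)
    also have "d * norm t \<le> d * ((1 + sqrt (spectral_norm B) / sqrt m) * norm y)"
      using 2 d by (rule mult_left_mono)
    finally show ?thesis by (simp add: mult_left_mono spectral_norm_nonneg)
  qed
  finally show ?thesis by (simp add: t mult_ac)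
qed

end

section \<open>One step for one eigenvector\<close>

text \<open>With \<open>y\<close> and \<open>x\<close> the components of \<open>v\<close> and \<open>w\<close> outside of an invariant subspace of \<open>H\<close>, the
  eigenvalue equation gives \<open>(H - r) y + D (y - x) = 0\<close> on the complement, exactly, because
  \<open>D w = 0\<close> and \<open>v - w = y - x\<close>.  Pairing with \<open>y\<close> yields the contraction.\<close>

lemma eigenvector_contraction:
  fixes H D P :: "complex^'m^'m"
  assumes P: "hermitian P" "\<And>x. P *v (P *v x) = P *v x" "\<And>x. H *v (P *v x) = P *v (H *v x)"
    and gap: "\<And>y. P *v y = 0 \<Longrightarrow> a * (norm y)\<^sup>2 \<le> y \<bullet> (H *v y)" and r: "r \<le> a"
    and D: "psd D" "\<And>y. energy D y \<le> sqrt b * norm y" and b: "b > 0"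
    and v: "(H + D) *v v = complex_of_real r *s v"
    and w: "D *v w = 0" "P *v w = P *v v"
  shows "(1 + (a - r) / b) * energy D (v - P *v v) \<le> energy D (w - P *v w)"
proof -
  define y where "y = v - P *v v"
  define x where "x = w - P *v w"
  have Py: "P *v y = 0" by (simp add: y_def matrix_vector_mult_diff_distrib P(2))
  have yP: "y \<bullet> (P *v z) = 0" for z
    using hermitian_inner[OF P(1), of y z] by (simp add: Py)
  have "v - w = y - x" by (simp add: y_def x_def w(2))
  then have "D *v v = D *v (y - x)"
    using w(1) matrix_vector_mult_diff_distrib[of D v w] by simp
  then have "y \<bullet> (H *v v) + y \<bullet> (D *v (y - x)) = r * (y \<bullet> v)"
    using v by (metis (no_types, lifting) inner_add_right inner_scaleR_right
        matrix_vector_mult_add_rdistrib of_real_smult)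
  moreover have "y \<bullet> v = (norm y)\<^sup>2"
  proof -
    have "v = y + P *v v" by (simp add: y_def)
    then have "y \<bullet> v = y \<bullet> y + y \<bullet> (P *v v)" by (metis inner_add_right)
    then show ?thesis by (simp add: yP power2_norm_eq_inner)
  qed
  moreover have "y \<bullet> (H *v v) = y \<bullet> (H *v y)"
  proof -
    have "v = y + P *v v" by (simp add: y_def)
    then have "H *v v = H *v y + P *v (H *v v)" by (metis matrix_vector_right_distrib P(3))
    then have "y \<bullet> (H *v v) = y \<bullet> (H *v y) + y \<bullet> (P *v (H *v v))" by (metis inner_add_right)
    then show ?thesis by (simp add: yP)
  qed
  moreover have "y \<bullet> (D *v (y - x)) = (energy D y)\<^sup>2 - y \<bullet> (D *v x)"
    by (simp add: matrix_vector_mult_diff_distrib inner_diff_right energy_sq[OF D(1)])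
  moreover have "y \<bullet> (D *v x) \<le> energy D y * energy D x"
    using energy_Cauchy_Schwarz[OF D(1), of y x] by linarith
  moreover have "a * (norm y)\<^sup>2 \<le> y \<bullet> (H *v y)" by (rule gap[OF Py])
  ultimately have main: "(a - r) * (norm y)\<^sup>2 + (energy D y)\<^sup>2 \<le> energy D y * energy D x"
    by (simp add: algebra_simps)
  have nn: "0 \<le> energy D y" "0 \<le> energy D x" by (simp_all add: energy_nonneg D(1))
  have "(energy D y)\<^sup>2 \<le> b * (norm y)\<^sup>2"
    using power_mono[OF D(2) nn(1), of 2] b by (simp add: power_mult_distrib)
  then have "(a - r) / b * (energy D y)\<^sup>2 \<le> (a - r) / b * (b * (norm y)\<^sup>2)"
    using r b by (intro mult_left_mono) auto
  also have "\<dots> = (a - r) * (norm y)\<^sup>2" using b by simp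
  finally have "energy D y * ((1 + (a - r) / b) * energy D y) \<le> energy D y * energy D x"
    using main by (simp add: algebra_simps power2_eq_square)
  then show ?thesis
    using nn by (cases "energy D y = 0") (auto simp: y_def[symmetric] x_def[symmetric] mult_le_cancel_left)
qed

section \<open>One step of the iteration\<close>

text \<open>This is the square root of the trace of \<^term>\<open>defect B V\<close> times the projector of \<open>W\<close>.  It measures the
  distance of the range of \<open>W\<close> from that of \<open>V\<close> in the seminorm in which the iteration is, to first
  order, a contraction.\<close>

definition range_error :: "complex^'m^'m \<Rightarrow> complex^'n^'m \<Rightarrow> complex^'n^'m \<Rightarrow> real" where
  "range_error B V W = sqrt (\<Sum>i\<in>UNIV. (energy (defect B V) (column i W))\<^sup>2)"

lemma range_error_nonneg: "0 \<le> range_error B V W"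
  by (simp add: range_error_def sum_nonneg)

lemma range_error_sq: "(range_error B V W)\<^sup>2 = (\<Sum>i\<in>UNIV. (energy (defect B V) (column i W))\<^sup>2)"
  by (simp add: range_error_def sum_nonneg)

text \<open>The range of \<open>W\<close> serves as the trial space in the minimax principle: the defect vanishes there,
  and \<open>H\<close> exceeds its \<open>n\<close>-th eigenvalue there only to second order in the distance \<open>d\<close>.\<close>

lemma eigenvalue_compressed_le:
  fixes H B :: "complex^'m^'m" and V W :: "complex^('n::{finite,linorder})^'m"
  assumes H: "hermitian H" and V: "lowest_eigenvectors H V"
    and nm: "CARD('n) < CARD('m)" and gap: "eigengap (CARD('n)) H > 0"
    and B: "neg_definite B" and W: "orthonormal_columns W"
    and VW: "\<And>c. norm (W *v c - col_projector V *v (W *v c)) \<le> d * norm c"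
  shows "eigenvalues (H + defect B W) ! (CARD('n) - 1)
    \<le> eigenvalues H ! (CARD('n) - 1) + (spectral_norm H + \<bar>eigenvalues H ! (CARD('n) - 1)\<bar>) * d\<^sup>2"
proof (rule eigenvalue_le_form[OF _ W])
  show "hermitian (H + defect B W)"
    using H hermitian_defect[OF B W] by (simp add: hermitian_def adj_add)
  show "CARD('n) \<le> CARD('m)" using nm by simp
  define l where "l = eigenvalues H ! (CARD('n) - 1)"
  fix c
  have V': "orthonormal_columns V" by (rule lowest_orthonormal[OF H V])
  define x where "x = W *v c"
  define p where "p = col_projector V *v x"
  define q where "q = x - p"
  have Pp: "col_projector V *v p = p" by (simp add: p_def col_projector_idem V')
  have Hp: "col_projector V *v (H *v p) = H *v p"
    using lowest_projector_commute[OF H V, of p] by (simp add: Pp)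
  have Pq: "col_projector V *v q = 0"
    by (simp add: q_def p_def matrix_vector_mult_diff_distrib col_projector_idem V')
  \<comment> \<open>The range of \<open>V\<close> and its complement are invariant under \<open>H\<close>, so the form splits.\<close>
  have cross: "q \<bullet> (H *v p) = 0"
    using hermitian_inner[OF hermitian_col_projector, of V q "H *v p"] by (simp add: Hp Pq)
  then have cross': "p \<bullet> (H *v q) = 0"
    using hermitian_inner[OF H, of p q] by (simp add: inner_commute)
  have "x = p + q" by (simp add: q_def)
  then have "x \<bullet> (H *v x) = p \<bullet> (H *v p) + q \<bullet> (H *v q)"
    using cross cross' by (simp add: inner_add_left inner_add_right matrix_vector_right_distrib)
  moreover have "p \<bullet> (H *v p) \<le> l * (norm p)\<^sup>2"
    unfolding l_def by (rule lowest_form_le[OF H V nm gap Pp])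
  moreover have "q \<bullet> (H *v q) \<le> spectral_norm H * (norm q)\<^sup>2"
  proof -
    have "q \<bullet> (H *v q) \<le> norm q * norm (H *v q)" by (rule norm_cauchy_schwarz)
    also have "\<dots> \<le> norm q * (spectral_norm H * norm q)"
      by (intro mult_left_mono norm_matrix_vector_le) simp
    finally show ?thesis by (simp add: power2_eq_square mult_ac)
  qed
  moreover have "(norm x)\<^sup>2 = (norm p)\<^sup>2 + (norm q)\<^sup>2"
    unfolding p_def q_def by (rule norm_col_projector_pythagoras[OF V'])
  ultimately have "x \<bullet> (H *v x) \<le> l * (norm x)\<^sup>2 + (spectral_norm H - l) * (norm q)\<^sup>2"
    by (simp add: algebra_simps)
  also have "(spectral_norm H - l) * (norm q)\<^sup>2 \<le> (spectral_norm H + \<bar>l\<bar>) * (norm q)\<^sup>2"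
    by (intro mult_right_mono) auto
  also have "\<dots> \<le> (spectral_norm H + \<bar>l\<bar>) * (d * norm c)\<^sup>2"
    unfolding q_def p_def x_def
    by (intro mult_left_mono power_mono VW) (auto simp: spectral_norm_nonneg)
  finally have "x \<bullet> (H *v x) \<le> (l + (spectral_norm H + \<bar>l\<bar>) * d\<^sup>2) * (norm c)\<^sup>2"
    by (simp add: x_def norm_isometry W power_mult_distrib algebra_simps)
  moreover have "(H + defect B W) *v x = H *v x"
    by (simp add: x_def matrix_vector_mult_add_rdistrib defect_isometry_eq_0[OF B W])
  ultimately show "(W *v c) \<bullet> ((H + defect B W) *v (W *v c))
      \<le> (eigenvalues H ! (CARD('n) - 1)
         + (spectral_norm H + \<bar>eigenvalues H ! (CARD('n) - 1)\<bar>) * d\<^sup>2) * (norm c)\<^sup>2"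
    by (simp add: x_def l_def)
qed

lemma spectral_norm_pos:
  fixes B :: "complex^'m^'m"
  assumes "m > 0" "\<And>x. m * (norm x)\<^sup>2 \<le> - (x \<bullet> (B *v x))"
  shows "0 < spectral_norm B"
proof -
  define x :: "complex^'m" where "x = axis undefined 1"
  have "m \<le> spectral_norm B"
    using assms(2)[of x] neg_form_le[of x B] by (simp add: x_def norm_axis_1)
  then show ?thesis using assms(1) by simp
qed

text \<open>The contraction of \<open>eigenvector_contraction\<close> holds in the seminorm of the defect at \<open>W\<close> and
  compares each new eigenvector with a lifted vector in the range of \<open>W\<close>.  Passing to the defect at \<open>V\<close>
  costs the two factors with \<open>c1\<close>, the shift of the eigenvalues the term with \<open>c2\<close>, and replacing the
  lifted vectors by the orthonormal columns of \<open>W\<close> the square root.\<close>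

lemma range_error_step:
  fixes H B :: "complex^'m^'m" and V W W' :: "complex^('n::{finite,linorder})^'m" and m :: real
  defines "b \<equiv> spectral_norm B"
  defines "c1 \<equiv> sqrt b / sqrt m * (1 + sqrt b / sqrt m)"
    and "c2 \<equiv> spectral_norm H + \<bar>eigenvalues H ! (CARD('n) - 1)\<bar>"
  assumes H: "hermitian H" and V: "lowest_eigenvectors H V"
    and nm: "CARD('n) < CARD('m)" and gap: "eigengap (CARD('n)) H > 0"
    and B: "neg_definite B" and m: "m > 0" "\<And>x. m * (norm x)\<^sup>2 \<le> - (x \<bullet> (B *v x))"
    and W: "orthonormal_columns W" and W': "lowest_eigenvectors (H + defect B W) W'"
    and VW: "\<And>c. norm (W *v c - col_projector V *v (W *v c)) \<le> d * norm c"
    and WV: "\<And>c. norm (V *v c - col_projector W *v (V *v c)) \<le> d * norm c"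
    and d: "0 \<le> d" "d < 1" and small: "c1 * d \<le> 1" "c2 * d\<^sup>2 \<le> eigengap (CARD('n)) H"
  shows "(1 - c1 * d) * (1 + (eigengap (CARD('n)) H - c2 * d\<^sup>2) / b) * sqrt (1 - d\<^sup>2) * range_error B V W'
      \<le> (1 + c1 * d) * range_error B V W"
proof -
  define g where "g = eigengap (CARD('n)) H - c2 * d\<^sup>2"
  have b: "b > 0" unfolding b_def by (rule spectral_norm_pos[OF m])
  have c1: "c1 \<ge> 0" using b m by (simp add: c1_def)
  have V': "orthonormal_columns V" by (rule lowest_orthonormal[OF H V])
  define P where "P = col_projector V"
  define D where "D = defect B W"
  define E where "E = defect B V"
  have D: "psd D" unfolding D_def by (rule psd_defect[OF B W])
  have E: "psd E" unfolding E_def by (rule psd_defect[OF B V'])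
  have HD: "hermitian (H + D)"
    using H D by (simp add: psd_def hermitian_def adj_add)
  \<comment> \<open>On the complement, the seminorms of the two defects agree up to a factor near 1.\<close>
  have up: "energy D y \<le> (1 + c1 * d) * energy E y" and low: "(1 - c1 * d) * energy E y \<le> energy D y"
    if "P *v y = 0" for y
  proof -
    have "norm y \<le> energy E y / sqrt m"
      using energy_defect_ge[OF B m V'] that m(1) by (simp add: E_def P_def field_simps)
    then have "sqrt b * d * (1 + sqrt b / sqrt m) * norm y
        \<le> sqrt b * d * (1 + sqrt b / sqrt m) * (energy E y / sqrt m)"
      using b m d by (intro mult_left_mono) auto
    also have "\<dots> = c1 * d * energy E y" by (simp add: c1_def)
    finally have *: "sqrt b * d * (1 + sqrt b / sqrt m) * norm y \<le> c1 * d * energy E y" .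
    show "energy D y \<le> (1 + c1 * d) * energy E y"
      using energy_defect_compare[OF B m V' W WV d(1), of y] * by (simp add: D_def E_def b_def algebra_simps)
    show "(1 - c1 * d) * energy E y \<le> energy D y"
      using energy_defect_compare[OF B m W V' VW d(1), of y] * by (simp add: D_def E_def b_def algebra_simps)
  qed
  have shift: "energy E (y - P *v y) = energy E y" for y
    unfolding E_def P_def by (rule energy_defect_col_projector[OF B V'])
  obtain K where KW: "\<And>x. \<exists>c. K *v x = W *v c" and PK: "\<And>x. P *v (K *v x) = P *v x"
    and K: "\<And>x. norm (K *v x) \<le> norm x / sqrt (1 - d\<^sup>2)"
    using lift_exists[OF V' W VW d] unfolding P_def by metis
  have PP: "P *v (P *v x) = P *v x" for x by (simp add: P_def col_projector_idem V')
  have vec: "(1 - c1 * d) * (1 + g / b) * energy E (column i W')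
      \<le> (1 + c1 * d) * energy E (K *v column i W')" for i
  proof -
    \<comment> \<open>The new eigenvector and the vector of the old range with the same projection.\<close>
    define v where "v = column i W'"
    define w where "w = K *v v"
    define r where "r = eigenvalues (H + D) ! col_index i"
    define a where "a = eigenvalues H ! CARD('n)"
    have "r \<le> eigenvalues (H + D) ! (CARD('n) - 1)"
      unfolding r_def
    proof (intro sorted_nth_mono sorted_eigenvalues)
      show "col_index i \<le> CARD('n) - 1" using col_index_lt_card[of i] by simp
      obtain f where "length (eigenvalues (H + D)) = CARD('m)"
        using hermitian_eigenbasis[OF HD] by blast
      then show "CARD('n) - 1 < length (eigenvalues (H + D))" using nm by simp
    qed
    also have "\<dots> \<le> eigenvalues H ! (CARD('n) - 1) + c2 * d\<^sup>2"
      unfolding D_def c2_def by (rule eigenvalue_compressed_le[OF H V nm gap B W VW])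
    finally have r: "g \<le> a - r"
      by (simp add: g_def a_def eigengap_def)
    have g0: "0 \<le> g" using small by (simp add: g_def)
    have "(1 + (a - r) / b) * energy D (v - P *v v) \<le> energy D (w - P *v w)"
    proof (rule eigenvector_contraction[where H=H])
      show "hermitian P" unfolding P_def by (rule hermitian_col_projector)
      show "H *v (P *v x) = P *v (H *v x)" for x
        unfolding P_def by (rule lowest_projector_commute[OF H V])
      show "a * (norm y)\<^sup>2 \<le> y \<bullet> (H *v y)" if "P *v y = 0" for y
        using complement_form_ge[OF H V nm gap] that by (simp add: a_def P_def)
      show "energy D y \<le> sqrt b * norm y" for y
        using energy_defect_le_neg[OF B W, of y] energy_neg_le[of B y] by (simp add: D_def b_def)
      show "(H + D) *v v = complex_of_real r *s v"
        unfolding v_def r_def using W' unfolding D_def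
        by (rule lowest_eigenvector[OF HD[unfolded D_def]])
      obtain c where "w = W *v c" using KW[of v] by (auto simp: w_def)
      then show "D *v w = 0" by (simp add: D_def defect_isometry_eq_0[OF B W])
      show "P *v w = P *v v" unfolding w_def by (rule PK)
    qed (use PP D b r g0 in auto)
    moreover have "(1 + g / b) * energy D (v - P *v v) \<le> (1 + (a - r) / b) * energy D (v - P *v v)"
      using r b by (intro mult_right_mono energy_nonneg D) (auto simp: divide_right_mono)
    moreover have "(1 + g / b) * ((1 - c1 * d) * energy E (v - P *v v)) \<le> (1 + g / b) * energy D (v - P *v v)"
      using g0 b by (intro mult_left_mono low) (auto simp: matrix_vector_mult_diff_distrib PP)
    moreover have "energy D (w - P *v w) \<le> (1 + c1 * d) * energy E (w - P *v w)"
      by (rule up) (simp add: matrix_vector_mult_diff_distrib PP)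
    ultimately show ?thesis
      by (simp add: shift v_def w_def mult_ac)
  qed
  define L where "L = (1 - c1 * d) * (1 + g / b)"
  have L: "0 \<le> L" using small b by (simp add: L_def g_def)
  have "(L * range_error B V W')\<^sup>2 = (\<Sum>i\<in>UNIV. (L * energy E (column i W'))\<^sup>2)"
    by (simp add: power_mult_distrib range_error_sq sum_distrib_left E_def)
  also have "\<dots> \<le> (\<Sum>i\<in>UNIV. ((1 + c1 * d) * energy E (K *v column i W'))\<^sup>2)"
    using vec L by (intro sum_mono power_mono) (auto simp: L_def intro: mult_nonneg_nonneg energy_nonneg[OF E])
  also have "\<dots> = (1 + c1 * d)\<^sup>2 * (\<Sum>i\<in>UNIV. (energy E (K *v column i W'))\<^sup>2)"
    by (simp add: power_mult_distrib sum_distrib_left)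
  also have "\<dots> \<le> (1 + c1 * d)\<^sup>2 * ((1 / sqrt (1 - d\<^sup>2))\<^sup>2 * (\<Sum>i\<in>UNIV. (energy E (column i W))\<^sup>2))"
    using K by (intro mult_left_mono sum_energy_lift_le[OF E lowest_orthonormal[OF HD W'[folded D_def]] W KW])
      auto
  also have "\<dots> = ((1 + c1 * d) * (range_error B V W / sqrt (1 - d\<^sup>2)))\<^sup>2"
    by (simp add: power_mult_distrib power_divide range_error_sq E_def)
  finally have "L * range_error B V W' \<le> (1 + c1 * d) * (range_error B V W / sqrt (1 - d\<^sup>2))"
    by (rule power2_le_imp_le) (use c1 d in \<open>auto intro!: mult_nonneg_nonneg divide_nonneg_nonneg
      simp: range_error_nonneg power_le_one\<close>)
  moreover have "0 < sqrt (1 - d\<^sup>2)" using d by (simp add: power_less_one_iff)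
  ultimately show ?thesis
    by (simp add: L_def g_def field_simps)
qed

section \<open>Comparison of the error measures\<close>

lemma range_error_le_spectral_norm:
  fixes V W :: "complex^'n^'m"
  assumes B: "neg_definite B" and V: "orthonormal_columns V" and W: "orthonormal_columns W"
  shows "range_error B V W
    \<le> sqrt (real CARD('n)) * sqrt (spectral_norm B) * spectral_norm (col_projector V - col_projector W)"
proof -
  define s where "s = spectral_norm (col_projector V - col_projector W)"
  have "energy (defect B V) (column i W) \<le> sqrt (spectral_norm B) * s" for i
  proof -
    have "energy (defect B V) (column i W) = energy (defect B V) (column i W - col_projector V *v column i W)"
      by (rule energy_defect_col_projector[OF B V, symmetric])
    also have "\<dots> \<le> sqrt (spectral_norm B) * norm (column i W - col_projector V *v column i W)"
      using energy_defect_le_neg[OF B V] energy_neg_le by (rule order_trans)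
    also have "norm (column i W - col_projector V *v column i W)
        = norm ((col_projector V - col_projector W) *v column i W)"
      by (simp add: matrix_vector_mult_diff_rdistrib col_projector_column W norm_minus_commute)
    also have "\<dots> \<le> s"
      using norm_matrix_vector_le[of "col_projector V - col_projector W" "column i W"]
      by (simp add: s_def norm_column W)
    finally show ?thesis by (simp add: mult_left_mono spectral_norm_nonneg)
  qed
  then have "(\<Sum>i\<in>UNIV. (energy (defect B V) (column i W))\<^sup>2)
      \<le> (\<Sum>i\<in>(UNIV :: 'n set). (sqrt (spectral_norm B) * s)\<^sup>2)"
    by (intro sum_mono power_mono energy_nonneg psd_defect[OF B V])
  then have "range_error B V W \<le> sqrt (real CARD('n) * (sqrt (spectral_norm B) * s)\<^sup>2)"
    unfolding range_error_def by (intro real_sqrt_le_mono) simp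
  also have "\<dots> = sqrt (real CARD('n)) * (sqrt (spectral_norm B) * s)"
    by (simp add: real_sqrt_mult s_def spectral_norm_nonneg)
  finally show ?thesis by (simp add: s_def)
qed

lemma norm_complement_le_range_error:
  fixes V W :: "complex^'n^'m"
  assumes B: "neg_definite B" and m: "m > 0" "\<And>x. m * (norm x)\<^sup>2 \<le> - (x \<bullet> (B *v x))"
    and V: "orthonormal_columns V" and W: "orthonormal_columns W"
  shows "norm (W *v c - col_projector V *v (W *v c)) \<le> real CARD('n) / sqrt m * range_error B V W * norm c"
    and "norm (V *v c - col_projector W *v (V *v c)) \<le> real CARD('n) / sqrt m * range_error B V W * norm c"
proof -
  define q where "q = range_error B V W / sqrt m"
  have q0: "0 \<le> q" using m by (simp add: q_def range_error_nonneg)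
  have "m * (norm (column i W - col_projector V *v column i W))\<^sup>2 \<le> (energy (defect B V) (column i W))\<^sup>2" for i
  proof -
    have "sqrt m * norm (column i W - col_projector V *v column i W)
        \<le> energy (defect B V) (column i W - col_projector V *v column i W)"
      by (rule energy_defect_ge[OF B m V])
        (simp add: matrix_vector_mult_diff_distrib col_projector_idem V)
    then have "(sqrt m * norm (column i W - col_projector V *v column i W))\<^sup>2
        \<le> (energy (defect B V) (column i W))\<^sup>2"
      using m by (intro power_mono) (auto simp: energy_defect_col_projector[OF B V])
    then show ?thesis using m by (simp add: power_mult_distrib)
  qed
  then have "(\<Sum>i\<in>UNIV. m * (norm (column i W - col_projector V *v column i W))\<^sup>2) \<le> (range_error B V W)\<^sup>2"
    unfolding range_error_sq by (intro sum_mono)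
  then have sW: "(\<Sum>i\<in>UNIV. (norm (column i W - col_projector V *v column i W))\<^sup>2) \<le> q\<^sup>2"
    using m by (simp add: q_def power_divide sum_distrib_left[symmetric] field_simps)
  then have sV: "(\<Sum>i\<in>UNIV. (norm (column i V - col_projector W *v column i V))\<^sup>2) \<le> q\<^sup>2"
    by (simp only: sum_projector_complement_sym[OF V W])
  have le: "norm (z i) \<le> q" if "(\<Sum>i\<in>UNIV. (norm (z i))\<^sup>2) \<le> q\<^sup>2"
    for z :: "'n \<Rightarrow> complex^'m" and i
  proof (rule power2_le_imp_le[OF _ q0])
    have "(norm (z i))\<^sup>2 \<le> (\<Sum>i\<in>UNIV. (norm (z i))\<^sup>2)"
      by (rule member_le_sum) auto
    then show "(norm (z i))\<^sup>2 \<le> q\<^sup>2" using that by simp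
  qed
  have "norm (column i W - col_projector V *v column i W) \<le> q" for i
    using le[OF sW] .
  moreover have "norm (column i V - col_projector W *v column i V) \<le> q" for i
    using le[OF sV] .
  ultimately have "norm (W *v c - col_projector V *v (W *v c)) \<le> real CARD('n) * q * norm c"
    "norm (V *v c - col_projector W *v (V *v c)) \<le> real CARD('n) * q * norm c"
    by (intro norm_complement_isometry_le; simp)+
  then
  show "norm (W *v c - col_projector V *v (W *v c)) \<le> real CARD('n) / sqrt m * range_error B V W * norm c"
    and "norm (V *v c - col_projector W *v (V *v c)) \<le> real CARD('n) / sqrt m * range_error B V W * norm c"
    by (simp_all add: q_def)
qed

lemma spectral_norm_le_range_error:
  fixes V W :: "complex^'n^'m"
  assumes B: "neg_definite B" and m: "m > 0" "\<And>x. m * (norm x)\<^sup>2 \<le> - (x \<bullet> (B *v x))"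
    and V: "orthonormal_columns V" and W: "orthonormal_columns W"
  shows "spectral_norm (col_projector V - col_projector W)
    \<le> 2 * (real CARD('n) / sqrt m * range_error B V W)"
  unfolding spectral_norm_def
  using m by (intro onorm_le norm_projector_diff_le[OF V W]
      norm_complement_le_range_error[OF B m V W]) (simp add: range_error_nonneg)

lemma tendsto_iff_spectral_norm:
  fixes X :: "nat \<Rightarrow> complex^'n^'m"
  shows "X \<longlonglongrightarrow> P \<longleftrightarrow> (\<lambda>k. spectral_norm (P - X k)) \<longlonglongrightarrow> 0"
proof
  assume X: "X \<longlonglongrightarrow> P"
  have bound: "spectral_norm M \<le> (\<Sum>i\<in>UNIV. \<Sum>j\<in>UNIV. cmod (M $ i $ j))" for M :: "complex^'n^'m"
    unfolding spectral_norm_def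
  proof (rule onorm_le)
    fix x :: "complex^'n"
    have "norm (M *v x) \<le> (\<Sum>i\<in>UNIV. cmod ((M *v x) $ i))"
      unfolding norm_vec_def by (rule L2_set_le_sum) simp
    also have "\<dots> \<le> (\<Sum>i\<in>UNIV. \<Sum>j\<in>UNIV. cmod (M $ i $ j) * norm x)"
    proof (rule sum_mono)
      fix i
      have "cmod ((M *v x) $ i) \<le> (\<Sum>j\<in>UNIV. cmod (M $ i $ j * x $ j))"
        by (simp add: matrix_vector_mult_def norm_sum)
      also have "\<dots> \<le> (\<Sum>j\<in>UNIV. cmod (M $ i $ j) * norm x)"
        by (intro sum_mono) (simp add: norm_mult mult_left_mono Finite_Cartesian_Product.norm_nth_le)
      finally show "cmod ((M *v x) $ i) \<le> (\<Sum>j\<in>UNIV. cmod (M $ i $ j) * norm x)" .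
    qed
    finally show "norm (M *v x) \<le> (\<Sum>i\<in>UNIV. \<Sum>j\<in>UNIV. cmod (M $ i $ j)) * norm x"
      by (simp add: sum_distrib_right)
  qed
  have "(\<lambda>k. \<Sum>i\<in>UNIV. \<Sum>j\<in>UNIV. cmod ((P - X k) $ i $ j)) \<longlonglongrightarrow> (\<Sum>i\<in>UNIV. \<Sum>j\<in>UNIV. cmod ((P - P) $ i $ j))"
    by (intro tendsto_intros X)
  then have "(\<lambda>k. \<Sum>i\<in>UNIV. \<Sum>j\<in>UNIV. cmod ((P - X k) $ i $ j)) \<longlonglongrightarrow> 0" by simp
  then show "(\<lambda>k. spectral_norm (P - X k)) \<longlonglongrightarrow> 0"
    by (rule tendsto_sandwich[OF _ _ tendsto_const, rotated 2])
       (auto simp: spectral_norm_nonneg simp del: vector_minus_component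
         intro!: always_eventually bound)
next
  assume s: "(\<lambda>k. spectral_norm (P - X k)) \<longlonglongrightarrow> 0"
  have entry: "cmod (M $ i $ j) \<le> spectral_norm M" for M :: "complex^'n^'m" and i j
  proof -
    have "cmod (M $ i $ j) = cmod ((M *v axis j 1) $ i)"
      by (simp add: column_eq[symmetric] column_def)
    also have "\<dots> \<le> norm (M *v axis j 1)" by (rule Finite_Cartesian_Product.norm_nth_le)
    also have "\<dots> \<le> spectral_norm M"
      using norm_matrix_vector_le[of M "axis j 1"] by (simp add: norm_axis_1)
    finally show ?thesis .
  qed
  show "X \<longlonglongrightarrow> P"
  proof (intro vec_tendstoI)
    fix i j
    have "cmod (X k $ i $ j - P $ i $ j) \<le> norm (spectral_norm (P - X k))" for k
      using entry[of "P - X k" i j] spectral_norm_nonneg[of "P - X k"]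
      by (simp add: norm_minus_commute)
    then have "(\<lambda>k. X k $ i $ j - P $ i $ j) \<longlonglongrightarrow> 0"
      by (intro Lim_transform_bound[OF _ s] always_eventually allI)
    then show "(\<lambda>k. X k $ i $ j) \<longlonglongrightarrow> P $ i $ j"
      by (rule LIM_zero_cancel)
  qed
qed

section \<open>Perturbed geometric decay\<close>

text \<open>All losses of one step are of first order in \<open>d\<close>: the product of the three factors on the left of
  the hypothesis is at least \<open>(b + l) / b * (1 - s d)\<close>, and \<open>s d \<le> 1/2\<close> allows the division.\<close>

lemma contraction_factor_bound:
  fixes b l c1 c2 d e e' s :: real
  assumes pos: "b > 0" "l > 0" "c1 \<ge> 0" "c2 \<ge> 0" "d \<ge> 0" "e' \<ge> 0"
    and s: "s = c1 + c2 / l + 1" "2 * s * d \<le> 1"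
    and step: "(1 - c1 * d) * (1 + (l - c2 * d\<^sup>2) / b) * sqrt (1 - d\<^sup>2) * e' \<le> (1 + c1 * d) * e"
  shows "e' \<le> b / (b + l) * (1 + 2 * (c1 + s) * d) * e"
proof -
  define u where "u = c1 * d"
  define v where "v = c2 / l * d"
  define t where "t = s * d"
  have nn: "0 \<le> u" "0 \<le> v" using pos by (simp_all add: u_def v_def)
  have t: "t = u + v + d" "t \<le> 1/2"
    using s(2) by (simp_all add: t_def u_def v_def s(1) algebra_simps)
  have d1: "d \<le> 1" using t nn by linarith
  have dd: "d\<^sup>2 \<le> d" using d1 pos by (simp add: power2_eq_square mult_left_le)
  have sq: "1 - d \<le> sqrt (1 - d\<^sup>2)"
  proof (rule real_le_rsqrt)
    show "(1 - d)\<^sup>2 \<le> 1 - d\<^sup>2" using dd by (simp add: power2_eq_square algebra_simps)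
  qed
  have gap: "(b + l) / b * (1 - v) \<le> 1 + (l - c2 * d\<^sup>2) / b"
  proof -
    have "c2 * d\<^sup>2 \<le> c2 * d" using dd pos by (intro mult_left_mono) auto
    also have "\<dots> = l * v" using pos by (simp add: v_def)
    also have "\<dots> \<le> (b + l) * v" using pos nn by (intro mult_right_mono) auto
    finally have "(b + l) * (1 - v) \<le> b + l - c2 * d\<^sup>2" by (simp add: algebra_simps)
    then have "(b + l) * (1 - v) / b \<le> (b + l - c2 * d\<^sup>2) / b"
      using pos by (intro divide_right_mono) auto
    also have "\<dots> = 1 + (l - c2 * d\<^sup>2) / b" using pos by (simp add: field_simps)
    finally show ?thesis by simp
  qed
  have prod: "1 - t \<le> (1 - u) * (1 - v) * (1 - d)"
  proof -
    have "1 - u - v \<le> (1 - u) * (1 - v)" using nn by (simp add: algebra_simps)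
    then have "(1 - u - v) * (1 - d) \<le> (1 - u) * (1 - v) * (1 - d)"
      using d1 by (intro mult_right_mono) auto
    moreover have "1 - t \<le> (1 - u - v) * (1 - d)"
      using nn pos by (simp add: t algebra_simps)
    ultimately show ?thesis by linarith
  qed
  have "(1 - t) * ((b + l) / b) \<le> (1 - u) * (1 - v) * (1 - d) * ((b + l) / b)"
    using prod pos by (intro mult_right_mono) auto
  also have "\<dots> = (1 - u) * ((b + l) / b * (1 - v)) * (1 - d)" by simp
  also have "\<dots> \<le> (1 - u) * (1 + (l - c2 * d\<^sup>2) / b) * sqrt (1 - d\<^sup>2)"
    using t nn d1 pos by (intro mult_mono gap sq mult_nonneg_nonneg order_trans[OF _ gap]) auto
  finally have "(1 - t) * ((b + l) / b) * e' \<le> (1 - u) * (1 + (l - c2 * d\<^sup>2) / b) * sqrt (1 - d\<^sup>2) * e'"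
    using pos by (intro mult_right_mono) auto
  also have "\<dots> \<le> (1 + u) * e" using step by (simp add: u_def)
  also have "\<dots> \<le> (1 - t) * ((1 + 2 * u + 2 * t) * e)"
  proof -
    have "0 \<le> (u + t) * (1 - 2 * t)" using nn t pos by (intro mult_nonneg_nonneg) auto
    then have "1 + u \<le> (1 - t) * (1 + 2 * u + 2 * t)" by (simp add: algebra_simps)
    moreover have "0 \<le> e"
    proof -
      have "0 \<le> (1 - t) * ((b + l) / b) * e'" using t pos by auto
      then have "0 \<le> (1 + u) * e"
        using \<open>(1 - t) * ((b + l) / b) * e' \<le> (1 - u) * (1 + (l - c2 * d\<^sup>2) / b) * sqrt (1 - d\<^sup>2) * e'\<close>
          \<open>(1 - u) * (1 + (l - c2 * d\<^sup>2) / b) * sqrt (1 - d\<^sup>2) * e' \<le> (1 + u) * e\<close> by linarith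
      then show ?thesis using nn by (simp add: zero_le_mult_iff)
    qed
    ultimately show ?thesis by (metis mult.assoc mult_right_mono)
  qed
  finally have "(1 - t) * ((b + l) / b * e') \<le> (1 - t) * ((1 + 2 * u + 2 * t) * e)"
    by (simp only: mult.assoc)
  then have "(b + l) / b * e' \<le> (1 + 2 * u + 2 * t) * e"
    by (rule mult_left_le_imp_le) (use t(2) in simp)
  also have "1 + 2 * u + 2 * t = 1 + 2 * (c1 + s) * d"
    by (simp add: u_def t_def algebra_simps)
  finally show ?thesis using pos by (simp add: field_simps)
qed

text \<open>The excess factors \<open>1 + C e\<^sub>k\<close> have a convergent product, because the \<open>e\<^sub>k\<close> decay geometrically
  at some rate below 1; so they cost a constant only, and the rate \<open>g\<close> itself is attained.\<close>

lemma perturbed_geometric_decay: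
  fixes g C \<rho> :: real
  assumes g: "0 < g" "g < 1" and C: "0 \<le> C" and \<rho>: "0 < \<rho>"
  obtains \<rho>' C' where "0 < \<rho>'" "0 \<le> C'"
    "\<And>e. (\<And>k::nat. 0 \<le> e k) \<Longrightarrow> (\<And>k. e k \<le> \<rho> \<Longrightarrow> e (Suc k) \<le> g * (1 + C * e k) * e k) \<Longrightarrow>
       e 0 \<le> \<rho>' \<Longrightarrow> (\<And>k. e k \<le> C' * g ^ k * e 0)"
proof -
  \<comment> \<open>An auxiliary rate between \<open>g\<close> and 1; below \<open>\<rho>'\<close> every step contracts at least by \<open>q\<close>.\<close>
  define q where "q = (1 + g) / 2"
  have q: "0 < q" "q < 1" "g < q" using g by (auto simp: q_def)
  define \<rho>' where "\<rho>' = min \<rho> ((q - g) / (g * (C + 1)))"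
  have \<rho>': "0 < \<rho>'" "\<rho>' \<le> \<rho>" using \<rho> q g C by (auto simp: \<rho>'_def)
  have fac: "g * (1 + C * \<rho>') \<le> q"
  proof -
    have "\<rho>' * (g * (C + 1)) \<le> q - g"
      using g C by (simp add: \<rho>'_def pos_le_divide_eq[symmetric])
    moreover have "\<rho>' * (g * C) \<le> \<rho>' * (g * (C + 1))" using g \<rho>' by (intro mult_left_mono) auto
    ultimately show ?thesis by (simp add: algebra_simps)
  qed
  define C' where "C' = exp (C * \<rho>' / (1 - q))"
  show ?thesis
  proof (rule that)
    show "0 < \<rho>'" "0 \<le> C'" using \<rho>' by (simp_all add: C'_def)
    fix e :: "nat \<Rightarrow> real" and k
    assume e: "\<And>k. 0 \<le> e k" and step: "\<And>k. e k \<le> \<rho> \<Longrightarrow> e (Suc k) \<le> g * (1 + C * e k) * e k"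
      and e0: "e 0 \<le> \<rho>'"
    have small: "e k \<le> q ^ k * \<rho>'" for k
    proof (induction k)
      case (Suc k)
      have "q ^ k * \<rho>' \<le> 1 * \<rho>'" using q \<rho>' by (intro mult_right_mono) (auto intro: power_le_one)
      with Suc have le: "e k \<le> \<rho>'" by simp
      then have "e (Suc k) \<le> g * (1 + C * e k) * e k" using \<rho>' by (intro step) simp
      also have "\<dots> \<le> q * e k"
      proof (rule mult_right_mono[OF _ e])
        have "g * (1 + C * e k) \<le> g * (1 + C * \<rho>')"
          using le g C by (intro mult_left_mono add_left_mono) auto
        then show "g * (1 + C * e k) \<le> q" using fac by simp
      qed
      also have "\<dots> \<le> q * (q ^ k * \<rho>')" using Suc q by (intro mult_left_mono) auto
      finally show ?case by (simp add: mult_ac)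
    qed (simp add: e0)
    have bound: "e k \<le> exp (C * \<rho>' * (\<Sum>j<k. q ^ j)) * g ^ k * e 0" for k
    proof (induction k)
      case (Suc k)
      have "q ^ k * \<rho>' \<le> 1 * \<rho>'" using q \<rho>' by (intro mult_right_mono) (auto intro: power_le_one)
      with small[of k] have "e k \<le> \<rho>" using \<rho>' by linarith
      then have "e (Suc k) \<le> g * (1 + C * e k) * e k" by (rule step)
      also have "\<dots> \<le> g * exp (C * (q ^ k * \<rho>')) * e k"
      proof (intro mult_right_mono mult_left_mono e)
        have "1 + C * e k \<le> 1 + C * (q ^ k * \<rho>')"
          using small[of k] C by (intro add_left_mono mult_left_mono) auto
        also have "\<dots> \<le> exp (C * (q ^ k * \<rho>'))" by (rule exp_ge_add_one_self)
        finally show "1 + C * e k \<le> exp (C * (q ^ k * \<rho>'))" .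
      qed (use g in auto)
      also have "\<dots> \<le> g * exp (C * (q ^ k * \<rho>')) * (exp (C * \<rho>' * (\<Sum>j<k. q ^ j)) * g ^ k * e 0)"
        using Suc g by (intro mult_left_mono) auto
      also have "\<dots> = (exp (C * (q ^ k * \<rho>')) * exp (C * \<rho>' * (\<Sum>j<k. q ^ j))) * g ^ Suc k * e 0"
        by simp
      also have "exp (C * (q ^ k * \<rho>')) * exp (C * \<rho>' * (\<Sum>j<k. q ^ j)) = exp (C * \<rho>' * (\<Sum>j<Suc k. q ^ j))"
        by (simp add: exp_add[symmetric] algebra_simps)
      finally show ?case .
    qed simp
    have "(\<Sum>j<k. q ^ j) \<le> 1 / (1 - q)"
      using q sum_gp_strict[of q k] by (simp add: divide_right_mono)
    then have "C * \<rho>' * (\<Sum>j<k. q ^ j) \<le> C * \<rho>' * (1 / (1 - q))"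
      using C \<rho>' by (intro mult_left_mono) auto
    then have "exp (C * \<rho>' * (\<Sum>j<k. q ^ j)) \<le> C'" by (simp add: C'_def)
    then have "exp (C * \<rho>' * (\<Sum>j<k. q ^ j)) * g ^ k * e 0 \<le> C' * g ^ k * e 0"
      using g e by (intro mult_right_mono) auto
    with bound[of k] show "e k \<le> C' * g ^ k * e 0" by simp
  qed
qed

text \<open>A constant absorbs the finitely many terms before the decay sets in.\<close>

lemma geometric_decay_from_tail:
  fixes e :: "nat \<Rightarrow> real"
  assumes g: "0 < g" and e: "\<And>k. 0 \<le> e k" and pos: "0 < e 0" and C: "0 \<le> C"
    and tail: "\<And>j. e (K + j) \<le> C * g ^ j * e K"
  shows "\<exists>C'. \<forall>k. e k \<le> C' * g ^ k * e 0"
proof -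
  define C' where "C' = (\<Sum>k<K. e k / (g ^ k * e 0)) + C * e K / (g ^ K * e 0)"
  have nn: "0 \<le> e k / (g ^ k * e 0)" for k using e g pos by simp
  have C'K: "0 \<le> C * e K / (g ^ K * e 0)" using C e g pos by simp
  have "e k \<le> C' * g ^ k * e 0" for k
  proof (cases "k < K")
    case True
    have "e k / (g ^ k * e 0) \<le> (\<Sum>k<K. e k / (g ^ k * e 0))"
      by (rule member_le_sum) (use True nn in auto)
    then have "e k / (g ^ k * e 0) \<le> C'" using C'K by (simp add: C'_def)
    then show ?thesis using g pos by (simp add: pos_divide_le_eq mult_ac)
  next
    case False
    then obtain j where k: "k = K + j" using le_Suc_ex by (metis not_less)
    have "C * e K / (g ^ K * e 0) \<le> C'" using nn by (simp add: C'_def sum_nonneg)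
    then have "C * e K \<le> C' * (g ^ K * e 0)" using g pos by (simp add: pos_divide_le_eq)
    then have "C * e K * g ^ j \<le> C' * (g ^ K * e 0) * g ^ j" using g by (intro mult_right_mono) auto
    then show ?thesis using tail[of j] by (simp add: k power_add mult_ac)
  qed
  then show ?thesis by blast
qed

section \<open>The iteration and its cost\<close>

lemma program_result_query_list:
  "program_result f (query_list qs c) = program_result f (c (map f qs))"
  by (induction qs arbitrary: c) simp_all

lemma query_count_query_list:
  "query_count f (query_list qs c) = length qs + query_count f (c (map f qs))"
  by (induction qs arbitrary: c) simp_all

lemma matrix_of_queried_columns:
  fixes V :: "complex^('n::{finite,linorder})^'m"
  shows "matrix_of_column_list (map ((*v) B) (column_list V)) = B ** V"
proof -
  have "col_index i < length (sorted_list_of_set (UNIV :: 'n set))" for i :: 'n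
    by (simp add: col_index_lt_card)
  then have "map ((*v) B) (column_list V) ! col_index i = B *v column i V" for i
    by (simp add: column_list_def enumeration_col_index)
  then show ?thesis
    by (simp add: matrix_of_column_list_def vec_eq_iff matrix_matrix_mult_def matrix_vector_mult_def
        column_def)
qed

text \<open>Step \<open>k\<close> queries the \<open>n\<close> columns of \<open>W k\<close>; by symmetry of \<open>B\<close> the answers also provide the
  right-hand factor of the compression.\<close>

lemma aci_program_correct:
  fixes A B :: "complex^'m^'m" and W :: "nat \<Rightarrow> complex^('n::{finite,linorder})^'m"
  assumes B: "hermitian B" and solve: "\<And>k. solve k (A + compression B (W k)) = W (Suc k)"
  shows "program_result ((*v) B) (aci_program A k solve (W 0)) = W k \<and>
    query_count ((*v) B) (aci_program A k solve (W 0)) = CARD('n) * k"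
  using solve
proof (induction k arbitrary: solve W)
  case (Suc k)
  have comp: "B ** W 0 ** matrix_inv (adj (W 0) ** (B ** W 0)) ** adj (B ** W 0) = compression B (W 0)"
    using B by (simp add: compression_def adj_mult hermitian_def matrix_mul_assoc)
  have len: "length (column_list (W 0)) = CARD('n)"
    by (simp add: column_list_def)
  have "solve 0 (A + compression B (W 0)) = W (Suc 0)" by (rule Suc.prems)
  then show ?case
    using Suc.IH[of "\<lambda>j. solve (Suc j)" "\<lambda>j. W (Suc j)"] Suc.prems
    by (simp add: program_result_query_list query_count_query_list matrix_of_queried_columns comp len)
qed simp

lemma aci_iteration_orthonormal: "aci_iteration A B W \<Longrightarrow> orthonormal_columns (W k)"
  by (cases k) (auto simp: aci_iteration_def lowest_eigenvectors_def)

lemma compressed_eq_defect: "A + compression B W = (A + B) + defect B W"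
  by (simp add: defect_def)

lemma hermitian_compressed:
  assumes "hermitian A" "neg_definite B" "orthonormal_columns W"
  shows "hermitian (A + compression B W)"
  using assms hermitian_defect[OF assms(2,3)]
  by (simp add: compressed_eq_defect hermitian_def adj_add neg_definite_def)

lemma aci_iteration_exists:
  fixes A B :: "complex^'m^'m" and U :: "complex^('n::{finite,linorder})^'m"
  assumes A: "hermitian A" and B: "neg_definite B" and nm: "CARD('n) \<le> CARD('m)"
    and U: "orthonormal_columns U"
  obtains W :: "nat \<Rightarrow> complex^('n::{finite,linorder})^'m" where "aci_iteration A B W" "W 0 = U"
proof -
  have "\<exists>W. \<forall>k. (orthonormal_columns (W k) \<and> (k = 0 \<longrightarrow> W k = U)) \<and>
      lowest_eigenvectors (A + compression B (W k)) (W (Suc k))"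
  proof (rule dependent_nat_choice)
    show "\<exists>W. orthonormal_columns W \<and> (0 = 0 \<longrightarrow> W = U)" using U by blast
    fix W :: "complex^('n::{finite,linorder})^'m" and k :: nat
    assume "orthonormal_columns W \<and> (k = 0 \<longrightarrow> W = U)"
    then obtain W' :: "complex^('n::{finite,linorder})^'m" where
      "lowest_eigenvectors (A + compression B W) W'"
      using lowest_eigenvectors_exist[OF hermitian_compressed[OF A B] nm] by blast
    then show "\<exists>W'. (orthonormal_columns W' \<and> (Suc k = 0 \<longrightarrow> W' = U)) \<and>
        lowest_eigenvectors (A + compression B W) W'"
      by (auto simp: lowest_eigenvectors_def)
  qed
  then obtain W where W: "\<forall>k. (orthonormal_columns (W k) \<and> (k = 0 \<longrightarrow> W k = U)) \<and>
      lowest_eigenvectors (A + compression B (W k)) (W (Suc k))" by blast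
  show ?thesis
    by (rule that[of W]) (use W in \<open>auto simp: aci_iteration_def\<close>)
qed

text \<open>Only the range of the matrix enters, because the nearest point in a definite inner product
  is unique.\<close>

lemma compression_determined_by_projector:
  fixes B :: "complex^'m^'m" and U W :: "complex^'n^'m"
  assumes B: "neg_definite B" and U: "orthonormal_columns U" and W: "orthonormal_columns W"
    and eq: "col_projector U = col_projector W"
  shows "compression B U = compression B W"
proof (rule matrix_eqI)
  fix y
  obtain t where t: "defect B U *v y = - (B *v (y - U *v t))"
    "\<And>r. (U *v r) \<bullet> (defect B U *v y) = 0" by (rule defect_decomposition[OF B U]) (rule that)
  obtain s where s: "defect B W *v y = - (B *v (y - W *v s))"
    "\<And>r. (W *v r) \<bullet> (defect B W *v y) = 0" by (rule defect_decomposition[OF B W]) (rule that)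
  \<comment> \<open>Both nearest points lie in the common range, to which both remainders are orthogonal.\<close>
  have "U *v t = W *v (adj W *v (U *v t))"
    using col_projector_isometry[OF U, of t] by (simp add: eq col_projector_vector)
  then have r1: "(W *v s - U *v t) \<bullet> (defect B W *v y) = 0"
    using s(2) by (metis diff_0_right inner_diff_left)
  have "W *v s = U *v (adj U *v (W *v s))"
    using col_projector_isometry[OF W, of s] by (simp add: eq[symmetric] col_projector_vector)
  then have r2: "(W *v s - U *v t) \<bullet> (defect B U *v y) = 0"
    using t(2) by (metis diff_0_right inner_diff_left)
  have "defect B W *v y - defect B U *v y = B *v (W *v s - U *v t)"
    by (simp add: s(1) t(1) matrix_vector_mult_diff_distrib)
  then have "(W *v s - U *v t) \<bullet> (B *v (W *v s - U *v t)) = 0"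
    using r1 r2 by (metis diff_0_right inner_diff_right)
  then have "W *v s - U *v t = 0"
    using B unfolding neg_definite_def by (metis less_irrefl)
  then have "defect B U *v y = defect B W *v y" by (simp add: s(1) t(1))
  then show "compression B U *v y = compression B W *v y"
    by (simp add: defect_def matrix_vector_mult_diff_rdistrib)
qed

lemma spectral_norm_diff_commute: "spectral_norm (M - N) = spectral_norm (N - M)"
  for M N :: "complex^'n^'m"
  unfolding spectral_norm_def onorm_def
  by (simp add: matrix_vector_mult_diff_rdistrib norm_minus_commute)

section \<open>Local convergence\<close>

lemma aci_step_rate:
  fixes A B :: "complex^'m^'m" and V :: "complex^('n::{finite,linorder})^'m"
  defines "l \<equiv> eigengap (CARD('n)) (A + B)"
  assumes nm: "CARD('n) < CARD('m)" and A: "hermitian A" and B: "neg_definite B"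
    and gap: "l > 0" and V: "lowest_eigenvectors (A + B) V"
  obtains C \<rho> where "0 \<le> C" "0 < \<rho>"
    "\<And>W W'. orthonormal_columns W \<Longrightarrow> lowest_eigenvectors (A + compression B W) W' \<Longrightarrow>
      range_error B V W \<le> \<rho> \<Longrightarrow>
      range_error B V W' \<le> spectral_norm B / (spectral_norm B + l) *
        (1 + C * range_error B V W) * range_error B V W"
proof -
  have H: "hermitian (A + B)" using A B by (simp add: hermitian_def adj_add neg_definite_def)
  have V': "orthonormal_columns V" by (rule lowest_orthonormal[OF H V])
  obtain m where m: "m > 0" "\<And>x. m * (norm x)\<^sup>2 \<le> - (x \<bullet> (B *v x))"
    using neg_definite_coercive[OF B] by blast
  define b where "b = spectral_norm B"
  have b: "b > 0" unfolding b_def by (rule spectral_norm_pos[OF m])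
  define c1 where "c1 = sqrt b / sqrt m * (1 + sqrt b / sqrt m)"
  define c2 where "c2 = spectral_norm (A + B) + \<bar>eigenvalues (A + B) ! (CARD('n) - 1)\<bar>"
  define s where "s = c1 + c2 / l + 1"
  \<comment> \<open>\<open>k\<close> times the error bounds the distance of the ranges; \<open>s\<close> collects the first-order losses.\<close>
  define k where "k = real CARD('n) / sqrt m"
  have c: "c1 \<ge> 0" "c2 \<ge> 0" using b m by (simp_all add: c1_def c2_def spectral_norm_nonneg)
  have s: "s \<ge> 1" using c gap by (simp add: s_def)
  have k: "k > 0" using m by (simp add: k_def)
  show ?thesis
  proof (rule that)
    show "0 \<le> 2 * (c1 + s) * k" "0 < 1 / (2 * s * k)" using c s k by auto
    fix W W' :: "complex^('n::{finite,linorder})^'m"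
    assume W: "orthonormal_columns W" and W': "lowest_eigenvectors (A + compression B W) W'"
      and small: "range_error B V W \<le> 1 / (2 * s * k)"
    define d where "d = k * range_error B V W"
    have d0: "0 \<le> d" using k by (simp add: d_def range_error_nonneg)
    have sd: "2 * s * d \<le> 1" using small s k by (simp add: d_def field_simps)
    have parts: "c1 * d \<le> s * d" "c2 / l * d \<le> s * d" "1 * d \<le> s * d"
      using c gap d0 by (intro mult_right_mono; simp add: s_def)+
    have d1: "d < 1" using parts sd by linarith
    have "c2 * d\<^sup>2 \<le> l"
    proof -
      have "c2 * d\<^sup>2 = l * (c2 / l * d) * d" using gap by (simp add: power2_eq_square)
      also have "\<dots> \<le> l * 1 * 1"
      proof (intro mult_mono order_refl)
        show "c2 / l * d \<le> 1" using parts sd d0 by linarith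
      qed (use d1 d0 gap c in auto)
      finally show ?thesis by simp
    qed
    then have "(1 - c1 * d) * (1 + (l - c2 * d\<^sup>2) / b) * sqrt (1 - d\<^sup>2) * range_error B V W'
        \<le> (1 + c1 * d) * range_error B V W"
      unfolding b_def c1_def c2_def l_def
      by (intro range_error_step[OF H V nm gap[unfolded l_def] B m W W'[unfolded compressed_eq_defect]])
        (use parts sd d0 d1 norm_complement_le_range_error[OF B m V' W]
          in \<open>auto simp: d_def k_def b_def c1_def c2_def l_def\<close>)
    then have "range_error B V W' \<le> b / (b + l) * (1 + 2 * (c1 + s) * d) * range_error B V W"
      by (rule contraction_factor_bound[OF b gap c d0 range_error_nonneg s_def sd])
    then show "range_error B V W' \<le> spectral_norm B / (spectral_norm B + l) *
        (1 + 2 * (c1 + s) * k * range_error B V W) * range_error B V W"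
      by (simp add: b_def d_def mult_ac)
  qed
qed

text \<open>The decay of the error in the seminorm of the defect at \<open>V\<close> is translated into the spectral norm.
  An iteration that converges from afar enters the neighbourhood after finitely many steps; if it
  starts at distance zero it stays there, which the bound also requires.\<close>

theorem aci_local_convergence:
  fixes A B :: "complex^'m^'m" and V :: "complex^('n::{finite,linorder})^'m"
  defines "l \<equiv> eigengap (CARD('n)) (A + B)"
  defines "g \<equiv> spectral_norm B / (spectral_norm B + l)"
  assumes nm: "CARD('n) < CARD('m)" and A: "hermitian A" and B: "neg_definite B"
    and gap: "l > 0" and V: "lowest_eigenvectors (A + B) V"
  shows
    "\<exists>C. \<exists>\<delta>>0. \<forall>W :: nat \<Rightarrow> complex^('n::{finite,linorder})^'m.
       aci_iteration A B W \<and> spectral_norm (col_projector V - col_projector (W 0)) < \<delta> \<longrightarrow>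
         (\<forall>k. spectral_norm (col_projector V - col_projector (W k))
           \<le> C * g ^ k * spectral_norm (col_projector V - col_projector (W 0)))" (is ?uniform)
    and "\<And>W :: nat \<Rightarrow> complex^('n::{finite,linorder})^'m.
       aci_iteration A B W \<Longrightarrow> (\<lambda>k. col_projector (W k)) \<longlonglongrightarrow> col_projector V \<Longrightarrow>
         \<exists>C. \<forall>k. spectral_norm (col_projector V - col_projector (W k))
           \<le> C * g ^ k * spectral_norm (col_projector V - col_projector (W 0))"
    and "0 < g" "g < 1"
proof -
  have H: "hermitian (A + B)" using A B by (simp add: hermitian_def adj_add neg_definite_def)
  have V': "orthonormal_columns V" by (rule lowest_orthonormal[OF H V])
  obtain m where m: "m > 0" "\<And>x. m * (norm x)\<^sup>2 \<le> - (x \<bullet> (B *v x))"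
    using neg_definite_coercive[OF B] by blast
  have b: "spectral_norm B > 0" by (rule spectral_norm_pos[OF m])
  show g: "0 < g" "g < 1" using b gap by (simp_all add: g_def)
  obtain C \<rho> where C: "0 \<le> C" "0 < \<rho>" and step:
    "\<And>W W'. orthonormal_columns W \<Longrightarrow> lowest_eigenvectors (A + compression B W) W' \<Longrightarrow>
      range_error B V W \<le> \<rho> \<Longrightarrow>
      range_error B V W' \<le> g * (1 + C * range_error B V W) * range_error B V W"
    using aci_step_rate[OF nm A B gap[unfolded l_def] V] unfolding g_def l_def by metis
  obtain \<rho>' C' where \<rho>': "0 < \<rho>'" "0 \<le> C'" and decay:
    "\<And>e k. (\<And>k::nat. 0 \<le> e k) \<Longrightarrow> (\<And>k. e k \<le> \<rho> \<Longrightarrow> e (Suc k) \<le> g * (1 + C * e k) * e k) \<Longrightarrow>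
       e 0 \<le> \<rho>' \<Longrightarrow> e k \<le> C' * g ^ k * e 0"
    using perturbed_geometric_decay[OF g C] by metis
  define err where "err W = range_error B V W" for W :: "complex^('n::{finite,linorder})^'m"
  define dist where "dist W = spectral_norm (col_projector V - col_projector W)"
    for W :: "complex^('n::{finite,linorder})^'m"
  define k1 where "k1 = 2 * (real CARD('n) / sqrt m)"
  define k2 where "k2 = sqrt (real CARD('n)) * sqrt (spectral_norm B)"
  have k: "k1 > 0" "k2 > 0" using m b by (simp_all add: k1_def k2_def)
  have err0: "0 \<le> err W" for W by (simp add: err_def range_error_nonneg)
  have dist_le: "dist W \<le> k1 * err W" and err_le: "err W \<le> k2 * dist W" if "orthonormal_columns W" for W
    using spectral_norm_le_range_error[OF B m V' that] range_error_le_spectral_norm[OF B V' that]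
    by (simp_all add: dist_def err_def k1_def k2_def)
  have tail: "err (W (j + k)) \<le> C' * g ^ k * err (W j)"
    if W: "aci_iteration A B W" and small: "err (W j) \<le> \<rho>'" for W j k
  proof -
    have "err (W (j + Suc i)) \<le> g * (1 + C * err (W (j + i))) * err (W (j + i))" if "err (W (j + i)) \<le> \<rho>" for i
      using that W unfolding err_def
      by (intro step aci_iteration_orthonormal[OF W]) (auto simp: aci_iteration_def)
    then show ?thesis
      using decay[of "\<lambda>i. err (W (j + i))" k] small err0 by simp
  qed
  have convert: "dist (W k) \<le> k1 * C'' * k2 * g ^ k * dist (W 0)"
    if W: "aci_iteration A B W" and C'': "0 \<le> C''" and le: "err (W k) \<le> C'' * g ^ k * err (W 0)" for W k C''
  proof -
    have "dist (W k) \<le> k1 * err (W k)" by (rule dist_le[OF aci_iteration_orthonormal[OF W]])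
    also have "\<dots> \<le> k1 * (C'' * g ^ k * err (W 0))" using le k by (intro mult_left_mono) auto
    also have "\<dots> \<le> k1 * (C'' * g ^ k * (k2 * dist (W 0)))"
      using k g C'' by (intro mult_left_mono err_le aci_iteration_orthonormal[OF W]) auto
    finally show ?thesis by (simp add: mult_ac)
  qed
  show ?uniform
  proof (rule exI[of _ "k1 * C' * k2"], rule exI[of _ "\<rho>' / k2"], intro conjI allI impI)
    show "0 < \<rho>' / k2" using \<rho>' k by simp
    fix W :: "nat \<Rightarrow> complex^('n::{finite,linorder})^'m" and i
    assume W: "aci_iteration A B W \<and> spectral_norm (col_projector V - col_projector (W 0)) < \<rho>' / k2"
    then have "k2 * dist (W 0) < \<rho>'" using k by (simp add: dist_def field_simps)
    then have "err (W 0) \<le> \<rho>'"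
      using err_le[OF aci_iteration_orthonormal, of A B W 0] W by simp
    then have "err (W i) \<le> C' * g ^ i * err (W 0)" using tail[of W 0 i] W by simp
    then show "spectral_norm (col_projector V - col_projector (W i))
        \<le> k1 * C' * k2 * g ^ i * spectral_norm (col_projector V - col_projector (W 0))"
      using convert[of W C' i] W \<rho>' by (simp add: dist_def)
  qed
  fix W :: "nat \<Rightarrow> complex^('n::{finite,linorder})^'m"
  assume W: "aci_iteration A B W" and conv: "(\<lambda>k. col_projector (W k)) \<longlonglongrightarrow> col_projector V"
  have orth: "orthonormal_columns (W k)" for k by (rule aci_iteration_orthonormal[OF W])
  \<comment> \<open>Dividing by the initial error in \<open>geometric_decay_from_tail\<close> requires the case distinction.\<close>
  have "\<exists>C''. \<forall>k. err (W k) \<le> C'' * g ^ k * err (W 0)"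
  proof (cases "err (W 0) = 0")
    case True
    then show ?thesis using tail[OF W, of 0] \<rho>' by auto
  next
    case False
    have "(\<lambda>k. dist (W k)) \<longlonglongrightarrow> 0"
      using conv by (simp add: tendsto_iff_spectral_norm dist_def)
    then have "\<forall>\<^sub>F k in sequentially. dist (W k) < \<rho>' / k2"
      by (rule order_tendstoD) (use \<rho>' k in simp)
    then obtain K where "dist (W K) < \<rho>' / k2"
      by (metis eventually_happens' sequentially_bot)
    then have "k2 * dist (W K) < \<rho>'" using k by (simp add: field_simps)
    then have "err (W K) \<le> \<rho>'" using err_le[OF orth[of K]] by simp
    then show ?thesis
      using geometric_decay_from_tail[of g "\<lambda>k. err (W k)" C' K] tail[OF W] g err0 \<rho>' False
      by (simp add: less_le)
  qed
  then obtain C'' where C'': "err (W k) \<le> C'' * g ^ k * err (W 0)" for k by blast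
  have "err (W k) \<le> \<bar>C''\<bar> * g ^ k * err (W 0)" for k
  proof (rule order_trans[OF C''])
    show "C'' * g ^ k * err (W 0) \<le> \<bar>C''\<bar> * g ^ k * err (W 0)"
      using g err0 by (intro mult_right_mono) auto
  qed
  then show "\<exists>C. \<forall>k. spectral_norm (col_projector V - col_projector (W k))
      \<le> C * g ^ k * spectral_norm (col_projector V - col_projector (W 0))"
    using convert[OF W, of "\<bar>C''\<bar>"] by (auto simp: dist_def)
qed

theorem theorem1p4:
  fixes A B :: "complex^'N^'N"
    and V :: "complex^('n::{finite,linorder})^'N"
    and P :: "complex^'N^'N"
    and n :: nat and lam_g :: real
  assumes n: "n = CARD('n)" "n < CARD('N)"
    and A: "hermitian A"
    and B: "hermitian B" "neg_definite B"
    and lam_g: "lam_g = eigengap n (A + B)" "lam_g > 0"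
    and V: "lowest_eigenvectors (A + B) V"
    and P: "P = col_projector V"
  shows "
    \<comment> \<open>the iteration can be started at every projector in \<open>D\<close> and stays in \<open>D\<close>\<close>
    (\<forall>P0 \<in> rank_projectors n. \<exists>W :: nat \<Rightarrow> complex^('n::{finite,linorder})^'N.
       aci_iteration A B W \<and> col_projector (W 0) = P0) \<and>
    (\<forall>W :: nat \<Rightarrow> complex^('n::{finite,linorder})^'N. aci_iteration A B W \<longrightarrow>
       (\<forall>k. col_projector (W k) \<in> rank_projectors n)) \<and>
    \<comment> \<open>a projector determines the next one, up to the choice in case of a tie\<close>
    (\<forall>(U :: complex^('n::{finite,linorder})^'N) (U' :: complex^('n::{finite,linorder})^'N)
      (W :: complex^('n::{finite,linorder})^'N) (W' :: complex^('n::{finite,linorder})^'N).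
       orthonormal_columns U \<longrightarrow> orthonormal_columns W \<longrightarrow> col_projector U = col_projector W \<longrightarrow>
       compression B U = compression B W \<and>
       (lowest_eigenvectors (A + compression B U) U' \<longrightarrow>
        lowest_eigenvectors (A + compression B W) W' \<longrightarrow>
        eigengap n (A + compression B U) > 0 \<longrightarrow> col_projector U' = col_projector W')) \<and>
    \<comment> \<open>local convergence\<close>
    (\<exists>\<delta>>0. \<forall>P0 \<in> rank_projectors n. spectral_norm (P0 - P) < \<delta> \<longrightarrow>
       (\<forall>W :: nat \<Rightarrow> complex^('n::{finite,linorder})^'N. aci_iteration A B W \<and> col_projector (W 0) = P0 \<longrightarrow>
          (\<lambda>k. col_projector (W k)) \<longlonglongrightarrow> P)) \<and>
    \<comment> \<open>number of matrix-vector products with \<open>B\<close>\<close>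
    (\<forall>(W :: nat \<Rightarrow> complex^('n::{finite,linorder})^'N) solve. aci_iteration A B W \<longrightarrow>
       (\<forall>k. solve k (A + compression B (W k)) = W (Suc k)) \<longrightarrow>
       (\<forall>k. program_result (\<lambda>v. B *v v) (aci_program A k solve (W 0)) = W k \<and>
            query_count (\<lambda>v. B *v v) (aci_program A k solve (W 0)) = n * k)) \<and>
    \<comment> \<open>convergence rate, for every convergent iteration and uniformly near \<open>P\<close>\<close>
    (\<exists>\<gamma>\<ge>0. \<gamma> \<le> spectral_norm B / (spectral_norm B + lam_g) \<and>
       (\<forall>W :: nat \<Rightarrow> complex^('n::{finite,linorder})^'N. aci_iteration A B W \<and> (\<lambda>k. col_projector (W k)) \<longlonglongrightarrow> P \<longrightarrow>
          (\<exists>C. \<forall>k. spectral_norm (P - col_projector (W k))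
                    \<le> C * \<gamma> ^ k * spectral_norm (P - col_projector (W 0)))) \<and>
       (\<exists>C. \<exists>\<delta>>0. \<forall>W :: nat \<Rightarrow> complex^('n::{finite,linorder})^'N.
          aci_iteration A B W \<and> spectral_norm (P - col_projector (W 0)) < \<delta> \<longrightarrow>
          (\<forall>k. spectral_norm (P - col_projector (W k))
                 \<le> C * \<gamma> ^ k * spectral_norm (P - col_projector (W 0)))))"
proof -
  have nm: "CARD('n) < CARD('N)" using n by simp
  define g where "g = spectral_norm B / (spectral_norm B + lam_g)"
  have gap: "eigengap (CARD('n)) (A + B) > 0" using lam_g n by simp
  note conv = aci_local_convergence[OF nm A B(2) gap V]
  have g: "0 < g" "g < 1"
    using conv(3,4) lam_g n by (simp_all add: g_def)
  have uniform: "\<exists>C. \<exists>\<delta>>0. \<forall>W :: nat \<Rightarrow> complex^('n::{finite,linorder})^'N.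
      aci_iteration A B W \<and> spectral_norm (P - col_projector (W 0)) < \<delta> \<longrightarrow>
      (\<forall>k. spectral_norm (P - col_projector (W k)) \<le> C * g ^ k * spectral_norm (P - col_projector (W 0)))"
    using conv(1) unfolding g_def P lam_g(1) n(1) .
  have rate: "\<exists>C. \<forall>k. spectral_norm (P - col_projector (W k)) \<le> C * g ^ k * spectral_norm (P - col_projector (W 0))"
    if "aci_iteration A B W" "(\<lambda>k. col_projector (W k)) \<longlonglongrightarrow> P"
    for W :: "nat \<Rightarrow> complex^('n::{finite,linorder})^'N"
    using conv(2)[of W] that unfolding g_def P lam_g(1) n(1) by blast
  have start: "\<exists>W :: nat \<Rightarrow> complex^('n::{finite,linorder})^'N. aci_iteration A B W \<and> col_projector (W 0) = P0"
    if "P0 \<in> rank_projectors n" for P0 :: "complex^'N^'N"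
  proof -
    obtain U :: "complex^('n::{finite,linorder})^'N" where U: "orthonormal_columns U" "col_projector U = P0"
      using rank_projectors_col_projector[where 'n='n, of P0] \<open>P0 \<in> rank_projectors n\<close> n(1) by blast
    obtain W :: "nat \<Rightarrow> complex^('n::{finite,linorder})^'N" where "aci_iteration A B W" "W 0 = U"
      using aci_iteration_exists[OF A B(2) _ U(1)] nm by auto
    then show ?thesis using U by blast
  qed
  have stay: "col_projector (W k) \<in> rank_projectors n" if "aci_iteration A B W"
    for W :: "nat \<Rightarrow> complex^('n::{finite,linorder})^'N" and k
    unfolding n(1) by (rule col_projector_rank_projectors[OF aci_iteration_orthonormal[OF that]])
  have determined: "compression B U = compression B W \<and>
       (lowest_eigenvectors (A + compression B U) U' \<longrightarrow>
        lowest_eigenvectors (A + compression B W) W' \<longrightarrow>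
        eigengap n (A + compression B U) > 0 \<longrightarrow> col_projector U' = col_projector W')"
    if "orthonormal_columns U" "orthonormal_columns W" "col_projector U = col_projector W"
    for U U' W W' :: "complex^('n::{finite,linorder})^'N"
  proof -
    have eq: "compression B U = compression B W"
      by (rule compression_determined_by_projector[OF B(2) that])
    then show ?thesis
      using lowest_projector_unique[OF hermitian_compressed[OF A B(2) that(1)], of U' W'] nm n(1) by simp
  qed
  have local: "\<exists>\<delta>>0. \<forall>P0 \<in> rank_projectors n. spectral_norm (P0 - P) < \<delta> \<longrightarrow>
       (\<forall>W :: nat \<Rightarrow> complex^('n::{finite,linorder})^'N. aci_iteration A B W \<and> col_projector (W 0) = P0 \<longrightarrow>
          (\<lambda>k. col_projector (W k)) \<longlonglongrightarrow> P)"
  proof -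
    obtain C \<delta> where \<delta>: "\<delta> > 0" and bound: "\<And>(W :: nat \<Rightarrow> complex^('n::{finite,linorder})^'N) k.
      aci_iteration A B W \<Longrightarrow> spectral_norm (P - col_projector (W 0)) < \<delta> \<Longrightarrow>
      spectral_norm (P - col_projector (W k)) \<le> C * g ^ k * spectral_norm (P - col_projector (W 0))"
      using uniform by blast
    have "(\<lambda>k. col_projector (W k)) \<longlonglongrightarrow> P"
      if W: "aci_iteration A B W" and small: "spectral_norm (col_projector (W 0) - P) < \<delta>"
      for W :: "nat \<Rightarrow> complex^('n::{finite,linorder})^'N"
      unfolding tendsto_iff_spectral_norm
    proof (rule tendsto_sandwich[OF _ _ tendsto_const])
      have "(\<lambda>k. C * g ^ k * spectral_norm (P - col_projector (W 0)))
          \<longlonglongrightarrow> C * 0 * spectral_norm (P - col_projector (W 0))"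
        using g by (intro tendsto_intros LIMSEQ_power_zero) auto
      then show "(\<lambda>k. C * g ^ k * spectral_norm (P - col_projector (W 0))) \<longlonglongrightarrow> 0" by simp
      show "\<forall>\<^sub>F k in sequentially. spectral_norm (P - col_projector (W k))
          \<le> C * g ^ k * spectral_norm (P - col_projector (W 0))"
        using bound[OF W] small by (simp add: spectral_norm_diff_commute)
    qed (simp add: spectral_norm_nonneg)
    then show ?thesis using \<delta> by blast
  qed
  have cost: "program_result (\<lambda>v. B *v v) (aci_program A k solve (W 0)) = W k \<and>
      query_count (\<lambda>v. B *v v) (aci_program A k solve (W 0)) = n * k"
    if "\<forall>k. solve k (A + compression B (W k)) = W (Suc k)"
    for W :: "nat \<Rightarrow> complex^('n::{finite,linorder})^'N" and solve k
    unfolding n(1) by (rule aci_program_correct[OF B(1)]) (use that in blast)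
  show ?thesis
  proof (intro conjI)
    show "\<exists>\<gamma>\<ge>0. \<gamma> \<le> spectral_norm B / (spectral_norm B + lam_g) \<and>
       (\<forall>W :: nat \<Rightarrow> complex^('n::{finite,linorder})^'N. aci_iteration A B W \<and> (\<lambda>k. col_projector (W k)) \<longlonglongrightarrow> P \<longrightarrow>
          (\<exists>C. \<forall>k. spectral_norm (P - col_projector (W k))
                    \<le> C * \<gamma> ^ k * spectral_norm (P - col_projector (W 0)))) \<and>
       (\<exists>C. \<exists>\<delta>>0. \<forall>W :: nat \<Rightarrow> complex^('n::{finite,linorder})^'N.
          aci_iteration A B W \<and> spectral_norm (P - col_projector (W 0)) < \<delta> \<longrightarrow>
          (\<forall>k. spectral_norm (P - col_projector (W k))
                 \<le> C * \<gamma> ^ k * spectral_norm (P - col_projector (W 0))))"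
      using g rate uniform by (intro exI[of _ g]) (auto simp: g_def[symmetric])
  qed (use start stay determined local cost in \<open>blast+\<close>)
qed

end
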